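(* Let $\mathbf{A}\in\mathbb{R}^{n\times n}$ be a nonzero symmetric positive semidefinite matrix, let $m\ge1$ be an integer (the sampling number), and let $\mu = \mathrm{tr}(\mathbf{A})/\|\mathbf{A}\|_2$ be the effective rank of $\mathbf{A}$. Then there exists $\varepsilon_{\mathrm{rel}}$ such that for all $\varepsilon\ge\varepsilon_{\mathrm{rel}}$, $$\Pr\big(|\mathrm{tr}_m^G(\mathbf{A}) - \mathrm{tr}(\mathbf{A})| \ge \varepsilon\,\mathrm{tr}(\mathbf{A})\big) \le \Pr\big(|\mathrm{tr}_m^G(\mathbf{A}_{\mathrm{rel}}) - 1| \ge \varepsilon\big) \le \Pr\big(|X-1|\ge\varepsilon\big),$$ where $X\sim\mathrm{Gamma}\big(\tfrac{m\mu}{2},\tfrac{m\mu}{2}\big)$ and $$\mathbf{A}_{\mathrm{rel}} = \frac{1}{\mu}\begin{bmatrix}\mathbf{I}_{\lfloor\mu\rfloor} & \mathbf{0} & \mathbf{0}\\ \mathbf{0} & \mu-\lfloor\mu\rfloor & \mathbf{0}\\ \mathbf{0}&\mathbf{0}&\mathbf{0}\end{bmatrix}.$$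
   Context: For a symmetric matrix $\mathbf{B}\in\mathbb{R}^{N\times N}$, the Gaussian trace estimator with $m$ samples is $\mathrm{tr}_m^G(\mathbf{B}) = \frac1m\sum_{j=1}^m \mathbf{z}_j^T\mathbf{B}\mathbf{z}_j$ with $\mathbf{z}_1,\ldots,\mathbf{z}_m$ i.i.d. standard Gaussian vectors in $\mathbb{R}^N$. $\mathbf{I}_k$ is the $k\times k$ identity; the trailing zero block of $\mathbf{A}_{\mathrm{rel}}$ may have any size (it does not affect the distribution of the estimator). $\mathrm{Gamma}(a,b)$ denotes the Gamma distribution with shape $a$ and rate $b$. *)

theory Defs
  imports "HOL-Probability.Probability"
begin

text \<open>Matrices in R^{n x n} are represented as functions nat => nat => real,
  only the entries with indices below n being relevant.\<close>

definition mat_trace :: "nat \<Rightarrow> (nat \<Rightarrow> nat \<Rightarrow> real) \<Rightarrow> real" where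
  "mat_trace n A = (\<Sum>i<n. A i i)"

definition mat_symmetric :: "nat \<Rightarrow> (nat \<Rightarrow> nat \<Rightarrow> real) \<Rightarrow> bool" where
  "mat_symmetric n A \<longleftrightarrow> (\<forall>i<n. \<forall>j<n. A i j = A j i)"

definition quad_form :: "nat \<Rightarrow> (nat \<Rightarrow> nat \<Rightarrow> real) \<Rightarrow> (nat \<Rightarrow> real) \<Rightarrow> real" where
  "quad_form n A x = (\<Sum>i<n. \<Sum>j<n. x i * A i j * x j)"

definition mat_psd :: "nat \<Rightarrow> (nat \<Rightarrow> nat \<Rightarrow> real) \<Rightarrow> bool" where
  "mat_psd n A \<longleftrightarrow> mat_symmetric n A \<and> (\<forall>x. quad_form n A x \<ge> 0)"

definition mat_nonzero :: "nat \<Rightarrow> (nat \<Rightarrow> nat \<Rightarrow> real) \<Rightarrow> bool" where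
  "mat_nonzero n A \<longleftrightarrow> (\<exists>i<n. \<exists>j<n. A i j \<noteq> 0)"

definition spec_norm :: "nat \<Rightarrow> (nat \<Rightarrow> nat \<Rightarrow> real) \<Rightarrow> real" where
  "spec_norm n A = Sup {sqrt (\<Sum>i<n. (\<Sum>j<n. A i j * x j)\<^sup>2) | x. (\<Sum>i<n. (x i)\<^sup>2) = 1}"

definition eff_rank :: "nat \<Rightarrow> (nat \<Rightarrow> nat \<Rightarrow> real) \<Rightarrow> real" where
  "eff_rank n A = mat_trace n A / spec_norm n A"

text \<open>Probability space of m i.i.d. standard Gaussian vectors z_1..z_m in R^N:
  the entry (j,i) is the i-th coordinate of z_{j+1}.\<close>
definition gauss_samples :: "nat \<Rightarrow> nat \<Rightarrow> (nat \<times> nat \<Rightarrow> real) measure" where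
  "gauss_samples m N = PiM ({..<m} \<times> {..<N}) (\<lambda>_. density lborel std_normal_density)"

definition trG :: "nat \<Rightarrow> nat \<Rightarrow> (nat \<Rightarrow> nat \<Rightarrow> real) \<Rightarrow> (nat \<times> nat \<Rightarrow> real) \<Rightarrow> real" where
  "trG m N B z = (1 / real m) * (\<Sum>j<m. \<Sum>i<N. \<Sum>k<N. z (j, i) * B i k * z (j, k))"

text \<open>A_rel = (1/mu) diag(I_{floor mu}, mu - floor mu, 0); we use the size floor mu + 1
  (trailing zero block of size 0, which does not affect the estimator's distribution).\<close>
definition A_rel :: "real \<Rightarrow> nat \<Rightarrow> nat \<Rightarrow> real" where
  "A_rel \<mu> i j = (if i = j then
      (if i < nat \<lfloor>\<mu>\<rfloor> then 1 / \<mu>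
       else if i = nat \<lfloor>\<mu>\<rfloor> then (\<mu> - of_int \<lfloor>\<mu>\<rfloor>) / \<mu> else 0)
    else 0)"

definition A_rel_dim :: "real \<Rightarrow> nat" where
  "A_rel_dim \<mu> = nat \<lfloor>\<mu>\<rfloor> + 1"

definition gamma_density :: "real \<Rightarrow> real \<Rightarrow> real \<Rightarrow> real" where
  "gamma_density a b x = (if x > 0 then b powr a * x powr (a - 1) * exp (- b * x) / Gamma a else 0)"

definition gamma_measure :: "real \<Rightarrow> real \<Rightarrow> real measure" where
  "gamma_measure a b = density lborel (gamma_density a b)"

end

theory Submission
  imports Defs
begin

text \<open>Only the behaviour for large deviations matters, since the threshold may depend on the matrix.
  For deviations above 1 the lower tail is empty. By rotation invariance the estimator is a
  weighted sum of independent chi-squares with m degrees of freedom; after scaling the largest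
  weight to 1, all three variables are compared at the same level t.
  If k weights are equal to 1 and R is the sum of the remaining terms, then
  P(S >= t) is asymptotic to E(exp(R/2)) P(G >= t), where G is Gamma(mk/2, 1/2), and
  E(exp(R/2)) is the product of the factors (1 - x)^(-m/2) over the remaining weights x.
  The tail of Gamma(a, 1/2) is of strictly larger order for larger a. Hence fewer than
  floor(mu) top weights, or a fractional part in the comparison with the Gamma law, are decided
  by the order of the tail. With exactly floor(mu) top weights the constants decide:
  prod (1 - x) > 1 - sum x as soon as two remaining weights are nonzero, and otherwise the laws agree.\<close>

section \<open>Diagonalising quadratic forms by plane rotations\<close>

text \<open>What is compared are tails, not the variables: all estimates are read off as t tends to
  infinity, so the threshold comes out of \<open>eventually\<close> statements and has no formula.
  Asymptotic equivalence alone decides no inequality; hence every case without a strict gap in order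
  or constant is settled by showing that the two laws are equal. The mean of exp(R/2) is finite
  because the weights in R lie strictly below the top one. A slightly larger exponent than 1/2 is
  then still integrable, and this supplies the domination for passing to the limit. So the top
  weights must be collected in G before anything else is done. A single level t = m * \<mu> * (1 +
  \<epsilon>) serves all three variables: for A and for A_rel the trace divided by the scaling
  factor is \<mu>, and the rate 1/2 is the one natural to chi-squares. Orthogonal maps appear only
  as products of plane rotations. The spectral theorem needs no others, and the invariance of the
  Gaussian measure then reduces to a substitution in the plane.\<close>

definition givens :: "'a \<Rightarrow> 'a \<Rightarrow> real \<Rightarrow> real \<Rightarrow> ('a \<Rightarrow> real) \<Rightarrow> 'a \<Rightarrow> real" where
  "givens i k c s x = x(i := c * x i - s * x k, k := s * x i + c * x k)"

text \<open>The inductive form reduces each property of \<open>T\<close> to one plane rotation.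
  Excluding \<open>s = 0\<close> loses nothing: it leaves the identity for c = 1 and the square of a
  quarter turn for c = -1. It allows the substitution behind Gaussian invariance to divide by
  \<open>s\<close>.\<close>

inductive_set rotations :: "'a set \<Rightarrow> (('a \<Rightarrow> real) \<Rightarrow> 'a \<Rightarrow> real) set" for I where
  rotations_id: "(\<lambda>x. x) \<in> rotations I"
| rotations_step: "T \<in> rotations I \<Longrightarrow> i \<in> I \<Longrightarrow> k \<in> I \<Longrightarrow> i \<noteq> k \<Longrightarrow> c\<^sup>2 + s\<^sup>2 = 1 \<Longrightarrow> s \<noteq> 0
    \<Longrightarrow> (\<lambda>x. givens i k c s (T x)) \<in> rotations I"

definition qform :: "'a set \<Rightarrow> ('a \<Rightarrow> 'a \<Rightarrow> real) \<Rightarrow> ('a \<Rightarrow> real) \<Rightarrow> real" where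
  "qform I A x = (\<Sum>i\<in>I. \<Sum>j\<in>I. x i * A i j * x j)"

text \<open>For a linear map \<open>T\<close>, the number \<open>T (unit_at p) a\<close> is the
  entry (a, p) of its matrix.\<close>

definition unit_at :: "'a \<Rightarrow> 'a \<Rightarrow> real" where
  "unit_at i = (\<lambda>j. if j = i then 1 else 0)"

section \<open>Products of plane rotations as orthogonal maps\<close>

lemma givens_in_rotations:
  assumes "i \<in> I" "k \<in> I" "i \<noteq> k" "c\<^sup>2 + s\<^sup>2 = 1" "s \<noteq> 0"
  shows "givens i k c s \<in> rotations I"
  using rotations_step[OF rotations_id assms] by simp

lemma rotations_comp:
  assumes "S \<in> rotations I" "T \<in> rotations I"
  shows "(\<lambda>x. S (T x)) \<in> rotations I"
  using assms(1) by induction (auto intro: assms(2) rotations_step)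

lemma rotations_mono:
  assumes "T \<in> rotations I" "I \<subseteq> J"
  shows "T \<in> rotations J"
  using assms(1) by induction (use assms(2) in \<open>auto intro: rotations.intros\<close>)

text \<open>Negating \<open>s\<close> inverts a plane rotation and respects the side conditions. The
  right inverse serves to write an arbitrary vector as \<open>T x\<close>.\<close>

lemma rotations_right_inverse:
  assumes "T \<in> rotations I"
  shows "\<exists>T'\<in>rotations I. \<forall>x. T (T' x) = x"
  using assms
proof induction
  case rotations_id
  then show ?case by (auto intro: rotations.rotations_id)
next
  case (rotations_step T i k c s)
  then obtain T' where T': "T' \<in> rotations I" "\<And>x. T (T' x) = x" by blast
  have G: "givens i k c (-s) \<in> rotations I"
    using rotations_step by (intro givens_in_rotations) auto
  have inv: "givens i k c s (givens i k c (-s) x) = x" for x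
  proof
    fix a
    have "c * (c * x i + s * x k) - s * (c * x k - s * x i) = (c\<^sup>2 + s\<^sup>2) * x i"
      "s * (c * x i + s * x k) + c * (c * x k - s * x i) = (c\<^sup>2 + s\<^sup>2) * x k"
      by (simp_all add: algebra_simps power2_eq_square)
    then show "givens i k c s (givens i k c (-s) x) a = x a"
      using \<open>i \<noteq> k\<close> \<open>c\<^sup>2 + s\<^sup>2 = 1\<close> by (simp add: givens_def)
  qed
  show ?case
    by (rule bexI[OF _ rotations_comp[OF T'(1) G]]) (simp add: T'(2) inv)
qed

lemma rotations_outside:
  assumes "T \<in> rotations I" "a \<notin> I"
  shows "T x a = x a"
  using assms(1) by induction (use assms(2) in \<open>auto simp: givens_def\<close>)

lemma sum_split_two:
  fixes f :: "'a \<Rightarrow> real"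
  assumes "finite I" "i \<in> I" "k \<in> I" "i \<noteq> k"
  shows "sum f I = f i + f k + sum f (I - {i, k})"
proof -
  have "sum f I = sum f (I - {i, k}) + sum f {i, k}"
    by (rule sum.subset_diff) (use assms in auto)
  then show ?thesis using \<open>i \<noteq> k\<close> by simp
qed

lemma rotations_norm:
  assumes "T \<in> rotations I" "finite I"
  shows "(\<Sum>a\<in>I. (T x a)\<^sup>2) = (\<Sum>a\<in>I. (x a)\<^sup>2)"
  using assms(1)
proof induction
  case (rotations_step T i k c s)
  let ?y = "T x" and ?z = "givens i k c s (T x)"
  have "(?z i)\<^sup>2 + (?z k)\<^sup>2 = (c\<^sup>2 + s\<^sup>2) * (?y i)\<^sup>2 + (c\<^sup>2 + s\<^sup>2) * (?y k)\<^sup>2"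
    using \<open>i \<noteq> k\<close> by (simp add: givens_def power2_eq_square algebra_simps)
  then have "(?z i)\<^sup>2 + (?z k)\<^sup>2 = (?y i)\<^sup>2 + (?y k)\<^sup>2" using rotations_step by simp
  moreover have "(\<Sum>a\<in>I-{i,k}. (?z a)\<^sup>2) = (\<Sum>a\<in>I-{i,k}. (?y a)\<^sup>2)"
    by (rule sum.cong) (auto simp: givens_def)
  ultimately show ?case
    using rotations_step.IH rotations_step.hyps assms(2)
    by (simp add: sum_split_two[of I i k "\<lambda>a. (?z a)\<^sup>2"] sum_split_two[of I i k "\<lambda>a. (?y a)\<^sup>2"])
qed simp

lemma rotations_linear:
  assumes "T \<in> rotations I" "finite I" "a \<in> I"
  shows "T x a = (\<Sum>p\<in>I. x p * T (unit_at p) a)"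
  using assms(1,3)
proof (induction arbitrary: a)
  case rotations_id
  have "(\<Sum>p\<in>I. x p * unit_at p a) = (\<Sum>p\<in>I. if p = a then x p else 0)"
    by (rule sum.cong) (auto simp: unit_at_def)
  then show ?case using rotations_id assms(2) by simp
next
  case (rotations_step T i k c s)
  have *: "T x i = (\<Sum>p\<in>I. x p * T (unit_at p) i)" "T x k = (\<Sum>p\<in>I. x p * T (unit_at p) k)"
    using rotations_step by auto
  show ?case
    using rotations_step.IH[OF rotations_step.prems]
    by (auto simp: givens_def * sum_distrib_left sum.distrib[symmetric] sum_subtractf[symmetric] algebra_simps
        intro!: sum.cong)
qed

text \<open>The sum over \<open>p\<close> is the inner product of rows \<open>a\<close> and
  \<open>b\<close> of the matrix of \<open>T\<close>. A plane rotation replaces rows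
  \<open>i\<close> and \<open>k\<close> by two orthonormal combinations of them, so the induction
  only has to follow the Gram matrix \<open>D\<close> of the rows.\<close>

lemma rotations_orthogonal:
  assumes "T \<in> rotations I" "finite I" "a \<in> I" "b \<in> I"
  shows "(\<Sum>p\<in>I. T (unit_at p) a * T (unit_at p) b) = (if a = b then 1 else 0)"
  using assms(1,3,4)
proof (induction arbitrary: a b)
  case rotations_id
  have "(\<Sum>p\<in>I. unit_at p a * unit_at p b) = (\<Sum>p\<in>I. if p = a then (if a = b then 1 else 0) else 0 :: real)"
    by (rule sum.cong) (auto simp: unit_at_def)
  then show ?case using rotations_id assms(2) by simp
next
  case (rotations_step T i k c s)
  define D where "D a b = (\<Sum>p\<in>I. T (unit_at p) a * T (unit_at p) b)" for a b
  have D: "D a b = (if a = b then 1 else 0)" if "a \<in> I" "b \<in> I" for a b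
    using rotations_step.IH that unfolding D_def by auto
  \<comment> \<open>Every new row is \<open>\<beta> a\<close> times the old row \<open>f a\<close>
    plus \<open>\<gamma> a\<close> times the old row \<open>g a\<close>, with coefficients 1 and 0
    for rows other than \<open>i\<close> and \<open>k\<close>. The new Gram matrix is then one
    bilinear expression in \<open>D\<close>.\<close>
  define f where "f a = (if a = i \<or> a = k then i else a)" for a
  define g where "g a = (if a = i \<or> a = k then k else a)" for a
  define \<beta> where "\<beta> a = (if a = i then c else if a = k then s else 1)" for a
  define \<gamma> where "\<gamma> a = (if a = i then -s else if a = k then c else 0)" for a
  have G: "givens i k c s y a = \<beta> a * y (f a) + \<gamma> a * y (g a)" for y a
    using \<open>i \<noteq> k\<close> by (auto simp: givens_def f_def g_def \<beta>_def \<gamma>_def)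
  have "(\<Sum>p\<in>I. givens i k c s (T (unit_at p)) a * givens i k c s (T (unit_at p)) b) =
     \<beta> a * \<beta> b * D (f a) (f b) + \<beta> a * \<gamma> b * D (f a) (g b) + \<gamma> a * \<beta> b * D (g a) (f b)
      + \<gamma> a * \<gamma> b * D (g a) (g b)"
    unfolding D_def G sum_distrib_left sum.distrib[symmetric]
    by (rule sum.cong) (auto simp: algebra_simps)
  also have "\<dots> = (if a = b then 1 else 0)"
  proof -
    have cs: "c * c + s * s = 1" "s * s + c * c = 1"
      using rotations_step.hyps by (simp_all add: power2_eq_square add.commute)
    show ?thesis
      using rotations_step.hyps(2-4) rotations_step.prems cs
      by (cases "a = i"; cases "a = k"; cases "b = i"; cases "b = k")
         (simp_all add: D f_def g_def \<beta>_def \<gamma>_def)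
  qed
  finally show ?case .
qed

lemma qform_rotation:
  assumes "T \<in> rotations I" "finite I" "\<And>i j. i \<in> I \<Longrightarrow> j \<in> I \<Longrightarrow> A i j = A j i"
  shows "\<exists>B. (\<forall>i\<in>I. \<forall>j\<in>I. B i j = B j i) \<and> (\<forall>x. qform I A (T x) = qform I B x)"
proof -
  define M where "M p a = T (unit_at p) a" for p a
  \<comment> \<open>In matrix notation this is T^T A T.\<close>
  define B where "B p q = (\<Sum>a\<in>I. \<Sum>b\<in>I. M p a * A a b * M q b)" for p q
  have "B p q = B q p" if "p \<in> I" "q \<in> I" for p q
    unfolding B_def
    by (subst sum.swap) (intro sum.cong refl, simp add: assms(3) mult_ac)
  moreover have "qform I A (T x) = qform I B x" for x
  proof -
    have "qform I A (T x) = (\<Sum>a\<in>I. \<Sum>b\<in>I. (\<Sum>p\<in>I. x p * M p a) * A a b * (\<Sum>q\<in>I. x q * M q b))"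
      unfolding qform_def
      by (intro sum.cong refl) (simp add: M_def rotations_linear[OF assms(1,2), of _ x])
    also have "\<dots> = (\<Sum>a\<in>I. \<Sum>b\<in>I. \<Sum>p\<in>I. \<Sum>q\<in>I. x p * (M p a * A a b * M q b) * x q)"
      by (intro sum.cong refl) (simp add: sum_distrib_left sum_distrib_right mult_ac)
    also have "\<dots> = (\<Sum>a\<in>I. \<Sum>p\<in>I. \<Sum>b\<in>I. \<Sum>q\<in>I. x p * (M p a * A a b * M q b) * x q)"
      by (rule sum.cong[OF refl], rule sum.swap)
    also have "\<dots> = (\<Sum>p\<in>I. \<Sum>a\<in>I. \<Sum>b\<in>I. \<Sum>q\<in>I. x p * (M p a * A a b * M q b) * x q)"
      by (rule sum.swap)
    also have "\<dots> = (\<Sum>p\<in>I. \<Sum>a\<in>I. \<Sum>q\<in>I. \<Sum>b\<in>I. x p * (M p a * A a b * M q b) * x q)"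
      by (rule sum.cong[OF refl], rule sum.cong[OF refl], rule sum.swap)
    also have "\<dots> = (\<Sum>p\<in>I. \<Sum>q\<in>I. \<Sum>a\<in>I. \<Sum>b\<in>I. x p * (M p a * A a b * M q b) * x q)"
      by (rule sum.cong[OF refl], rule sum.swap)
    also have "\<dots> = qform I B x"
      unfolding qform_def B_def by (simp add: sum_distrib_left sum_distrib_right mult_ac)
    finally show ?thesis .
  qed
  ultimately show ?thesis by blast
qed

section \<open>Diagonalisation by maximising the form on the sphere\<close>

lemma qform_cong: "(\<And>i. i \<in> I \<Longrightarrow> x i = y i) \<Longrightarrow> qform I A x = qform I A y"
  unfolding qform_def by (intro sum.cong) auto

lemma qform_scale: "qform I A (\<lambda>i. r * x i) = r\<^sup>2 * qform I A x"
  unfolding qform_def by (simp add: sum_distrib_left power2_eq_square mult_ac)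

text \<open>Compactness comes from the product topology on \<open>I\<close>: the sphere is closed
  and lies in the compact cube [-1,1]^I. The points of that topology are extensional functions, so
  vectors enter through \<open>restrict x I\<close>, which does not change the form.\<close>

lemma qform_attains_max_on_sphere:
  assumes "finite I" "I \<noteq> {}"
  shows "\<exists>v. (\<Sum>i\<in>I. (v i)\<^sup>2) = 1 \<and> (\<forall>x. (\<Sum>i\<in>I. (x i)\<^sup>2) = 1 \<longrightarrow> qform I A x \<le> qform I A v)"
proof -
  define X where "X = product_topology (\<lambda>_. euclideanreal) I"
  define S where "S = {x \<in> topspace X. (\<Sum>i\<in>I. (x i)\<^sup>2) \<in> {1}}"
  have coord: "continuous_map X euclideanreal (\<lambda>x. x i)" if "i \<in> I" for i
    unfolding X_def using that by (rule continuous_map_product_projection)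
  have closed: "closedin X S"
    unfolding S_def
    by (rule closedin_continuous_map_preimage[where Y = euclideanreal])
       (intro continuous_map_sum continuous_map_real_pow coord assms, simp_all)
  have "compactin X (PiE I (\<lambda>_. {-1..1}))"
    unfolding X_def by (subst compactin_PiE) auto
  moreover have sub: "x i \<in> {-1..1}" if "i \<in> I" "(\<Sum>i\<in>I. (x i)\<^sup>2) = 1" for x :: "'a \<Rightarrow> real" and i
  proof -
    have "(x i)\<^sup>2 \<le> (\<Sum>i\<in>I. (x i)\<^sup>2)"
      by (rule member_le_sum) (use that assms in auto)
    then have "\<bar>x i\<bar> \<le> 1" using that abs_square_le_1[of "x i"] by linarith
    then show ?thesis by auto
  qed
  have "S \<subseteq> PiE I (\<lambda>_. {-1..1})"
  proof
    fix x assume x: "x \<in> S"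
    then have "x i \<in> {-1..1}" if "i \<in> I" for i
      using sub[OF that, of x] by (simp add: S_def)
    with x show "x \<in> PiE I (\<lambda>_. {-1..1})"
      by (simp add: S_def X_def PiE_iff)
  qed
  ultimately have "compactin X S"
    using closed closed_compactin by blast
  moreover have "continuous_map X euclideanreal (qform I A)"
    unfolding qform_def[abs_def]
    by (intro continuous_map_sum continuous_map_real_mult coord assms) simp_all
  ultimately have "compactin euclideanreal (qform I A ` S)"
    by (rule image_compactin)
  then have "compact (qform I A ` S)" by simp
  moreover obtain p where "p \<in> I" using assms by blast
  have ext: "restrict x I \<in> S" if "(\<Sum>i\<in>I. (x i)\<^sup>2) = 1" for x :: "'a \<Rightarrow> real"
    using that by (simp add: S_def X_def PiE_iff)
  have "(\<Sum>i\<in>I. (unit_at p i)\<^sup>2) = (\<Sum>i\<in>I. if i = p then 1 else 0 :: real)"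
    by (rule sum.cong) (auto simp: unit_at_def)
  then have "(\<Sum>i\<in>I. (unit_at p i)\<^sup>2) = 1" using \<open>p \<in> I\<close> assms by simp
  then have "S \<noteq> {}" using ext by blast
  ultimately obtain w where "w \<in> qform I A ` S" "\<And>y. y \<in> qform I A ` S \<Longrightarrow> y \<le> w"
    using compact_attains_sup[of "qform I A ` S"] by auto
  then obtain v where v: "v \<in> S" "\<And>x. x \<in> S \<Longrightarrow> qform I A x \<le> qform I A v" by blast
  have "qform I A x \<le> qform I A v" if "(\<Sum>i\<in>I. (x i)\<^sup>2) = 1" for x
    using v(2)[OF ext[OF that]] qform_cong[of I "restrict x I" x] by simp
  then show ?thesis using v(1) by (auto simp: S_def)
qed

text \<open>Every vector is reached from a multiple of a coordinate vector by eliminating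
  its other coordinates one at a time.\<close>
lemma rotations_reach:
  assumes "finite F" "p \<notin> F" "insert p F \<subseteq> I" "\<And>i. i \<in> I \<Longrightarrow> i \<notin> insert p F \<Longrightarrow> v i = 0"
  shows "\<exists>T\<in>rotations I. \<exists>r. \<forall>i\<in>I. T (\<lambda>i. r * unit_at p i) i = v i"
  using assms
proof (induction F arbitrary: v rule: finite_induct)
  case empty
  then show ?case
    by (intro bexI[OF _ rotations_id] exI[of _ "v p"]) (auto simp: unit_at_def)
next
  case (insert k F)
  show ?case
  proof (cases "v k = 0")
    case True
    then show ?thesis using insert by (intro insert.IH) auto
  next
    case False
    define r where "r = sqrt ((v p)\<^sup>2 + (v k)\<^sup>2)"
    have r: "r > 0" "r\<^sup>2 = (v p)\<^sup>2 + (v k)\<^sup>2"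
      using False by (auto simp: r_def intro: add_nonneg_pos)
    define w where "w = v(p := r, k := 0)"
    have "\<exists>T\<in>rotations I. \<exists>r. \<forall>i\<in>I. T (\<lambda>i. r * unit_at p i) i = w i"
      using insert by (intro insert.IH) (auto simp: w_def)
    then obtain T r' where T: "T \<in> rotations I" "\<And>i. i \<in> I \<Longrightarrow> T (\<lambda>i. r' * unit_at p i) i = w i"
      by blast
    have pk: "p \<in> I" "k \<in> I" "p \<noteq> k" using insert by auto
    have "(\<lambda>x. givens p k (v p / r) (v k / r) (T x)) \<in> rotations I"
      using r False T(1) pk
      by (intro rotations_step) (auto simp: power_divide add_divide_distrib[symmetric])
    moreover have "givens p k (v p / r) (v k / r) (T (\<lambda>i. r' * unit_at p i)) i = v i" if "i \<in> I" for i
      using pk T(2) that r by (auto simp: givens_def w_def)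
    ultimately show ?thesis
      by (intro bexI[of _ "\<lambda>x. givens p k (v p / r) (v k / r) (T x)"] exI[of _ r']) auto
  qed
qed

text \<open>Near 0 the linear term dominates: at t = b / (|c| + 1) the quadratic term takes away at
  most half of it.\<close>

lemma linear_coeff_zero:
  fixes a b c :: real
  assumes "\<And>t. 2 * t * b + t\<^sup>2 * c \<le> 0"
  shows "b = 0"
proof (rule ccontr)
  assume "b \<noteq> 0"
  define t where "t = b / (\<bar>c\<bar> + 1)"
  have "t\<^sup>2 * (-c) \<le> t\<^sup>2 * (\<bar>c\<bar> + 1)"
    by (rule mult_left_mono) auto
  then have "t\<^sup>2 * c \<ge> - (t\<^sup>2 * (\<bar>c\<bar> + 1))"
    by simp
  also have "t\<^sup>2 * (\<bar>c\<bar> + 1) = t * b"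
    by (simp add: t_def power2_eq_square)
  finally have "2 * t * b + t\<^sup>2 * c \<ge> t * b" by (simp add: algebra_simps)
  moreover have "t * b = b\<^sup>2 / (\<bar>c\<bar> + 1)" by (simp add: t_def power2_eq_square)
  moreover have "b\<^sup>2 / (\<bar>c\<bar> + 1) > 0" using \<open>b \<noteq> 0\<close> by (intro divide_pos_pos) auto
  ultimately show False using assms[of t] by linarith
qed

lemma qform_insert:
  assumes "finite I" "p \<notin> I" "\<And>i. i \<in> I \<Longrightarrow> A i p = A p i"
  shows "qform (insert p I) A x = A p p * (x p)\<^sup>2 + 2 * x p * (\<Sum>j\<in>I. A p j * x j) + qform I A x"
proof -
  have "(\<Sum>i\<in>I. x i * A i p * x p) = x p * (\<Sum>j\<in>I. A p j * x j)"
    unfolding sum_distrib_left by (intro sum.cong) (auto simp: assms(3))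
  moreover have "(\<Sum>j\<in>I. x p * A p j * x j) = x p * (\<Sum>j\<in>I. A p j * x j)"
    unfolding sum_distrib_left by (intro sum.cong) auto
  ultimately show ?thesis
    using assms by (simp add: qform_def sum.distrib power2_eq_square algebra_simps)
qed

text \<open>A maximiser on the sphere is rotated onto the axis \<open>p\<close>. Maximality then
  makes the mixed terms with \<open>p\<close> vanish, and the block on the remaining indices is left
  to the induction hypothesis.\<close>

theorem qform_diagonalize:
  assumes "finite I" "\<And>i j. i \<in> I \<Longrightarrow> j \<in> I \<Longrightarrow> A i j = A j i"
  shows "\<exists>T\<in>rotations I. \<exists>l. \<forall>x. qform I A (T x) = (\<Sum>i\<in>I. l i * (x i)\<^sup>2)"
  using assms
proof (induction I arbitrary: A rule: finite_induct)
  case empty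
  then show ?case by (auto simp: qform_def intro: rotations_id)
next
  case (insert p I)
  let ?J = "insert p I"
  obtain v where v: "(\<Sum>i\<in>?J. (v i)\<^sup>2) = 1"
    "\<And>x. (\<Sum>i\<in>?J. (x i)\<^sup>2) = 1 \<Longrightarrow> qform ?J A x \<le> qform ?J A v"
    using qform_attains_max_on_sphere[of ?J A] insert.hyps by blast
  obtain T r where T: "T \<in> rotations ?J" "\<And>i. i \<in> ?J \<Longrightarrow> T (\<lambda>i. r * unit_at p i) i = v i"
  proof -
    have "\<exists>T\<in>rotations ?J. \<exists>r. \<forall>i\<in>?J. T (\<lambda>i. r * unit_at p i) i = v i"
      by (rule rotations_reach[of I]) (use insert.hyps in auto)
    then show ?thesis using that by blast
  qed
  obtain B where Bsym: "\<And>i j. i \<in> ?J \<Longrightarrow> j \<in> ?J \<Longrightarrow> B i j = B j i"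
    and B: "\<And>x. qform ?J A (T x) = qform ?J B x"
  proof -
    have "\<exists>B. (\<forall>i\<in>?J. \<forall>j\<in>?J. B i j = B j i) \<and> (\<forall>x. qform ?J A (T x) = qform ?J B x)"
      by (rule qform_rotation[OF T(1) _ insert.prems]) (use insert.hyps in auto)
    then obtain B where "\<forall>i\<in>?J. \<forall>j\<in>?J. B i j = B j i" "\<forall>x. qform ?J A (T x) = qform ?J B x"
      by (elim exE conjE)
    then show ?thesis by (intro that[of B]) auto
  qed
  have single: "(\<Sum>i\<in>?J. (s * unit_at p i)\<^sup>2) = s\<^sup>2" for s
  proof -
    have "(\<Sum>i\<in>?J. (s * unit_at p i)\<^sup>2) = (\<Sum>i\<in>?J. if i = p then s\<^sup>2 else 0)"
      by (rule sum.cong) (auto simp: unit_at_def)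
    then show ?thesis using insert.hyps by simp
  qed
  have norm: "(\<Sum>i\<in>?J. (T x i)\<^sup>2) = (\<Sum>i\<in>?J. (x i)\<^sup>2)" for x
    using rotations_norm[OF T(1)] insert.hyps by simp
  have "(\<Sum>i\<in>?J. (v i)\<^sup>2) = (\<Sum>i\<in>?J. (T (\<lambda>i. r * unit_at p i) i)\<^sup>2)"
    by (intro sum.cong refl) (simp add: T(2))
  also have "\<dots> = r\<^sup>2" by (simp only: norm single)
  finally have "(\<Sum>i\<in>?J. (v i)\<^sup>2) = r\<^sup>2" .
  then have r: "r\<^sup>2 = 1" using v by simp
  have Bins: "qform ?J B x = B p p * (x p)\<^sup>2 + 2 * x p * (\<Sum>j\<in>I. B p j * x j) + qform I B x" for x
    by (rule qform_insert) (use insert.hyps Bsym in auto)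
  have Q0: "(\<Sum>j\<in>I. B p j * (r * unit_at p j)) = 0" "qform I B (\<lambda>i. r * unit_at p i) = 0"
    using insert.hyps unfolding qform_def by (intro sum.neutral ballI; force simp: unit_at_def)+
  have "qform ?J A v = qform ?J B (\<lambda>i. r * unit_at p i)"
    unfolding B[symmetric] by (rule qform_cong) (simp add: T(2))
  also have "\<dots> = B p p"
    using r unfolding Bins Q0 by (simp add: unit_at_def)
  finally have Mv: "qform ?J A v = B p p" .
  \<comment> \<open>Homogeneity turns the maximum on the sphere into a bound for all nonzero
    vectors. In the rotated coordinates the maximiser is r e_p with r^2 = 1, so the maximum is
    \<open>B p p\<close>.\<close>
  have max: "qform ?J B x \<le> B p p * (\<Sum>i\<in>?J. (x i)\<^sup>2)" if "(\<Sum>i\<in>?J. (x i)\<^sup>2) > 0" for x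
  proof -
    define N where "N = (\<Sum>i\<in>?J. (x i)\<^sup>2)"
    have N: "N > 0" using that by (simp add: N_def)
    define y where "y = (\<lambda>i. 1 / sqrt N * x i)"
    have "(\<Sum>i\<in>?J. (y i)\<^sup>2) = (\<Sum>i\<in>?J. 1 / N * (x i)\<^sup>2)"
      by (rule sum.cong) (use N in \<open>auto simp: y_def power_mult_distrib power_divide\<close>)
    also have "\<dots> = 1" using N unfolding sum_distrib_left[symmetric] N_def[symmetric] by simp
    finally have "qform ?J A (T y) \<le> B p p"
      using v(2)[of "T y"] norm Mv by metis
    then have "1 / N * qform ?J B x \<le> B p p"
      unfolding B y_def qform_scale using N by (simp add: power_divide)
    then show ?thesis using N by (simp add: field_simps N_def)
  qed
  \<comment> \<open>First-order optimality: the test vector e_p + t e_j gives an inequality in t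
    with linear term \<open>2 * t * B p j\<close>.\<close>
  have zero: "B p j = 0" if j: "j \<in> I" for j
  proof (rule linear_coeff_zero[where c = "B j j - B p p"])
    fix t :: real
    define x where "x = (\<lambda>i. if i = p then 1 else if i = j then t else 0)"
    have pj: "p \<noteq> j" using insert.hyps j by auto
    have "(\<Sum>i\<in>I. (x i)\<^sup>2) = (\<Sum>i\<in>I. if i = j then t\<^sup>2 else 0)"
      using insert.hyps by (intro sum.cong) (auto simp: x_def)
    then have n: "(\<Sum>i\<in>?J. (x i)\<^sup>2) = 1 + t\<^sup>2" using insert.hyps j by (simp add: x_def)
    have "(\<Sum>i\<in>I. B p i * x i) = (\<Sum>i\<in>I. if i = j then B p i * t else 0)"
      using insert.hyps by (intro sum.cong) (auto simp: x_def)
    then have s1: "(\<Sum>i\<in>I. B p i * x i) = B p j * t" using insert.hyps j by simp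
    have xI: "x i = (if i = j then t else 0)" if "i \<in> I" for i
      using that insert.hyps by (auto simp: x_def)
    have "qform I B x = (\<Sum>i\<in>I. \<Sum>k\<in>I. if i = j then (if k = j then t * B j j * t else 0) else 0)"
      unfolding qform_def
      by (rule sum.cong[OF refl], rule sum.cong[OF refl], (subst (1 2) xI; assumption?), simp)
    also have "\<dots> = (\<Sum>i\<in>I. if i = j then t * B j j * t else 0)"
    proof (rule sum.cong[OF refl])
      fix i
      show "(\<Sum>k\<in>I. if i = j then (if k = j then t * B j j * t else 0) else 0)
          = (if i = j then t * B j j * t else 0)"
        using insert.hyps j by (cases "i = j") simp_all
    qed
    finally have s2: "qform I B x = B j j * t\<^sup>2" using insert.hyps j by (simp add: power2_eq_square)
    have "qform ?J B x \<le> B p p * (1 + t\<^sup>2)"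
      using max[of x] unfolding n by (simp add: add_pos_nonneg)
    moreover have "x p = 1" by (simp add: x_def)
    ultimately show "2 * t * B p j + t\<^sup>2 * (B j j - B p p) \<le> 0"
      unfolding Bins s1 s2 by (simp add: algebra_simps)
  qed
  \<comment> \<open>\<open>S\<close> rotates within \<open>I\<close> only and leaves the coordinate
    \<open>p\<close> alone, so composing it with \<open>T\<close> keeps the split already
    reached.\<close>
  obtain S l where S: "S \<in> rotations I" "\<And>x. qform I B (S x) = (\<Sum>i\<in>I. l i * (x i)\<^sup>2)"
    using insert.IH[of B] Bsym by blast
  have "qform ?J A (T (S x)) = (\<Sum>i\<in>?J. (l(p := B p p)) i * (x i)\<^sup>2)" for x
  proof -
    have "S x p = x p" using rotations_outside[OF S(1)] insert.hyps by blast
    moreover have "(\<Sum>j\<in>I. B p j * S x j) = 0"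
      by (rule sum.neutral) (simp add: zero)
    moreover have "(\<Sum>i\<in>I. (l(p := B p p)) i * (x i)\<^sup>2) = (\<Sum>i\<in>I. l i * (x i)\<^sup>2)"
      using insert.hyps by (intro sum.cong) auto
    ultimately show ?thesis
      unfolding B Bins S(2) sum.insert[OF insert.hyps] by (simp only: fun_upd_same)
  qed
  then have "\<forall>x. qform ?J A (T (S x)) = (\<Sum>i\<in>?J. (l(p := B p p)) i * (x i)\<^sup>2)" ..
  moreover have "(\<lambda>x. T (S x)) \<in> rotations ?J"
    by (rule rotations_comp[OF T(1) rotations_mono[OF S(1)]]) auto
  ultimately show ?case
    by (intro bexI[of _ "\<lambda>x. T (S x)"] exI[of _ "l(p := B p p)"])
qed

section \<open>Trace and spectral norm in terms of the eigenvalues\<close>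

lemma qform_unit_at_rotated:
  assumes "\<And>x. qform I A (T x) = (\<Sum>i\<in>I. l i * (x i)\<^sup>2)" "finite I" "p \<in> I"
  shows "qform I A (T (unit_at p)) = l p"
proof -
  have "(\<Sum>i\<in>I. l i * (unit_at p i)\<^sup>2) = (\<Sum>i\<in>I. if i = p then l i else 0)"
    by (rule sum.cong) (auto simp: unit_at_def)
  then show ?thesis using assms by simp
qed

text \<open>Summing the form over the vectors T e_p pairs each \<open>A a b\<close> with the inner
  product of rows \<open>a\<close> and \<open>b\<close> of \<open>T\<close>, which leaves the
  diagonal.\<close>

lemma trace_rotation:
  assumes "T \<in> rotations I" "finite I" "\<And>x. qform I A (T x) = (\<Sum>i\<in>I. l i * (x i)\<^sup>2)"
  shows "(\<Sum>i\<in>I. l i) = (\<Sum>i\<in>I. A i i)"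
proof -
  have "(\<Sum>p\<in>I. l p) = (\<Sum>p\<in>I. qform I A (T (unit_at p)))"
    by (intro sum.cong refl) (simp add: qform_unit_at_rotated[where l = l, OF assms(3,2)])
  also have "\<dots> = (\<Sum>a\<in>I. \<Sum>p\<in>I. \<Sum>b\<in>I. T (unit_at p) a * A a b * T (unit_at p) b)"
    unfolding qform_def by (rule sum.swap)
  also have "\<dots> = (\<Sum>a\<in>I. \<Sum>b\<in>I. \<Sum>p\<in>I. T (unit_at p) a * A a b * T (unit_at p) b)"
    by (rule sum.cong[OF refl], rule sum.swap)
  also have "\<dots> = (\<Sum>a\<in>I. \<Sum>b\<in>I. A a b * (\<Sum>p\<in>I. T (unit_at p) a * T (unit_at p) b))"
    unfolding sum_distrib_left by (intro sum.cong refl) (simp add: mult_ac)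
  also have "\<dots> = (\<Sum>a\<in>I. \<Sum>b\<in>I. if b = a then A a b else 0)"
    by (intro sum.cong refl) (simp add: rotations_orthogonal[OF assms(1,2)])
  also have "\<dots> = (\<Sum>a\<in>I. A a a)" using assms(2) by simp
  finally show ?thesis .
qed

lemma qform_diff:
  assumes "\<And>i j. i \<in> I \<Longrightarrow> j \<in> I \<Longrightarrow> A i j = A j i"
  shows "qform I A (\<lambda>i. x i - t * y i)
    = qform I A x - 2 * t * (\<Sum>i\<in>I. y i * (\<Sum>j\<in>I. A i j * x j)) + t\<^sup>2 * qform I A y"
proof -
  have 1: "(\<Sum>i\<in>I. y i * (\<Sum>j\<in>I. A i j * x j)) = (\<Sum>i\<in>I. \<Sum>j\<in>I. y i * A i j * x j)"
    by (simp add: sum_distrib_left mult_ac)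
  have 2: "(\<Sum>i\<in>I. \<Sum>j\<in>I. y i * A i j * x j) = (\<Sum>i\<in>I. \<Sum>j\<in>I. x i * A i j * y j)"
    by (subst sum.swap, rule sum.cong[OF refl], rule sum.cong[OF refl]) (simp add: assms mult_ac)
  have "qform I A (\<lambda>i. x i - t * y i) = (\<Sum>i\<in>I. \<Sum>j\<in>I.
      x i * A i j * x j - t * (y i * A i j * x j) - t * (x i * A i j * y j) + t\<^sup>2 * (y i * A i j * y j))"
    unfolding qform_def by (intro sum.cong refl) (simp add: algebra_simps power2_eq_square)
  also have "\<dots> = qform I A x - t * (\<Sum>i\<in>I. \<Sum>j\<in>I. y i * A i j * x j)
      - t * (\<Sum>i\<in>I. \<Sum>j\<in>I. x i * A i j * y j) + t\<^sup>2 * qform I A y"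
    unfolding qform_def by (simp add: sum.distrib sum_subtractf sum_distrib_left)
  finally show ?thesis unfolding 1 2 by simp
qed

lemma quad_form_eq_qform: "quad_form n A = qform {..<n} A"
  by (rule ext) (simp add: quad_form_def qform_def)

text \<open>The spectral norm is a supremum of |A x|, whereas the diagonalisation speaks of the form
  only. Semidefiniteness bridges the two: it yields |A x|^2 \<le> M Q(x) for the form Q and its
  largest coefficient M, hence |A x| \<le> M on the sphere.\<close>

lemma psd_spectrum:
  assumes "mat_psd n A" "mat_nonzero n A"
  obtains T l where "T \<in> rotations {..<n}" "\<And>x. quad_form n A (T x) = (\<Sum>i<n. l i * (x i)\<^sup>2)"
    "\<And>i. i < n \<Longrightarrow> 0 \<le> l i" "\<And>i. i < n \<Longrightarrow> l i \<le> spec_norm n A" "\<exists>i<n. l i = spec_norm n A"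
    "(\<Sum>i<n. l i) = mat_trace n A" "0 < spec_norm n A"
proof -
  let ?I = "{..<n}"
  have sym: "A i j = A j i" if "i \<in> ?I" "j \<in> ?I" for i j
    using assms(1) that by (simp add: mat_psd_def mat_symmetric_def)
  have psd: "0 \<le> qform ?I A x" for x
    using assms(1) by (simp add: mat_psd_def quad_form_eq_qform)
  have "\<exists>T\<in>rotations ?I. \<exists>l. \<forall>x. qform ?I A (T x) = (\<Sum>i\<in>?I. l i * (x i)\<^sup>2)"
    by (rule qform_diagonalize) (auto intro: sym)
  then obtain T l where T: "T \<in> rotations ?I" and l: "\<And>x. qform ?I A (T x) = (\<Sum>i\<in>?I. l i * (x i)\<^sup>2)"
    by blast
  have l0: "0 \<le> l i" if "i < n" for i
    using psd[of "T (unit_at i)"] qform_unit_at_rotated[where l = l, OF l, of i] that by simp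
  have "n > 0" using assms(2) by (auto simp: mat_nonzero_def)
  define M where "M = Max (l ` ?I)"
  have lM: "l i \<le> M" if "i < n" for i unfolding M_def using that by (intro Max_ge) auto
  have "M \<in> l ` ?I" unfolding M_def using \<open>n > 0\<close> by (intro Max_in) auto
  then obtain p where p: "p < n" "l p = M" by auto
  have M0: "0 \<le> M" using l0 p by metis
  define Ax where "Ax x i = (\<Sum>j\<in>?I. A i j * x j)" for x i
  define N where "N x = (\<Sum>i\<in>?I. (x i)\<^sup>2)" for x :: "nat \<Rightarrow> real"
  have rayleigh: "qform ?I A y \<le> M * N y" for y
  proof -
    obtain T' where T': "T' \<in> rotations ?I" "\<And>x. T (T' x) = x"
      using rotations_right_inverse[OF T] by blast
    have "qform ?I A y = (\<Sum>i\<in>?I. l i * (T' y i)\<^sup>2)" using l[of "T' y"] by (simp only: T'(2))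
    also have "\<dots> \<le> (\<Sum>i\<in>?I. M * (T' y i)\<^sup>2)"
      by (intro sum_mono mult_right_mono) (auto intro: lM)
    also have "\<dots> = M * N y"
      unfolding sum_distrib_left[symmetric] N_def by (simp add: rotations_norm[OF T'(1)])
    finally show ?thesis .
  qed
  \<comment> \<open>Nonnegativity of the form at x - t A x, combined with \<open>rayleigh\<close> at
    A x.\<close>
  have step: "0 \<le> qform ?I A x - 2 * t * N (Ax x) + t\<^sup>2 * (M * N (Ax x))" for t x
  proof -
    have "0 \<le> qform ?I A (\<lambda>i. x i - t * Ax x i)" by (rule psd)
    also have "\<dots> = qform ?I A x - 2 * t * N (Ax x) + t\<^sup>2 * qform ?I A (Ax x)"
      by (subst qform_diff) (auto intro: sym simp: N_def Ax_def power2_eq_square)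
    finally show ?thesis
      using mult_left_mono[OF rayleigh[of "Ax x"], of "t\<^sup>2"] by simp
  qed
  \<comment> \<open>For M = 0 the quadratic term in \<open>step\<close> disappears, and t = 1 forces
    A e_j = 0 for the column of a nonzero entry.\<close>
  have Mpos: "M > 0"
  proof (rule ccontr)
    assume "\<not> M > 0"
    then have M: "M = 0" using M0 by simp
    obtain i j where ij: "i < n" "j < n" "A i j \<noteq> 0" using assms(2) by (auto simp: mat_nonzero_def)
    have "N (Ax (unit_at j)) \<le> 0"
      using step[of "unit_at j" 1] rayleigh[of "unit_at j"] psd[of "unit_at j"] unfolding M by simp
    moreover have "(Ax (unit_at j) i)\<^sup>2 \<le> N (Ax (unit_at j))"
      unfolding N_def using ij by (intro member_le_sum) auto
    ultimately have "(Ax (unit_at j) i)\<^sup>2 \<le> 0" by linarith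
    moreover have "Ax (unit_at j) i = (\<Sum>k\<in>?I. if k = j then A i k else 0)"
      unfolding Ax_def by (rule sum.cong) (auto simp: unit_at_def)
    ultimately show False using ij by simp
  qed
  \<comment> \<open>The value t = 1 / M minimises the quadratic in \<open>step\<close>.\<close>
  have AxM: "N (Ax x) \<le> M * qform ?I A x" for x
    using step[of x "1 / M"] Mpos by (simp add: field_simps power2_eq_square)
  define v where "v = T (unit_at p)"
  have "(\<Sum>i\<in>?I. (unit_at p i)\<^sup>2) = (\<Sum>i\<in>?I. if i = p then 1 else 0 :: real)"
    by (rule sum.cong) (auto simp: unit_at_def)
  then have Nv: "N v = 1" using p unfolding N_def v_def by (simp add: rotations_norm[OF T])
  have Qv: "qform ?I A v = M"
    unfolding v_def using p qform_unit_at_rotated[where l = l, OF l, of p] by auto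
  \<comment> \<open>Expanding |A v - M v|^2 with |v| = 1 and form value M at v gives |A v| \<ge> M,
    without first showing that v is an eigenvector.\<close>
  have "0 \<le> (\<Sum>i\<in>?I. (Ax v i - M * v i)\<^sup>2)" by (intro sum_nonneg) simp
  also have "\<dots> = (\<Sum>i\<in>?I. (Ax v i)\<^sup>2 - 2 * M * (v i * Ax v i) + M\<^sup>2 * (v i)\<^sup>2)"
    by (intro sum.cong refl) (simp add: power2_diff power_mult_distrib)
  also have "\<dots> = N (Ax v) - 2 * M * (\<Sum>i\<in>?I. v i * Ax v i) + M\<^sup>2 * N v"
    by (simp add: N_def sum.distrib sum_subtractf sum_distrib_left)
  also have "(\<Sum>i\<in>?I. v i * Ax v i) = qform ?I A v"
    by (simp add: Ax_def qform_def sum_distrib_left mult_ac)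
  finally have "M\<^sup>2 \<le> N (Ax v)" by (simp add: Qv Nv power2_eq_square)
  moreover have "N (Ax v) \<le> M\<^sup>2" using AxM[of v] by (simp add: Qv power2_eq_square)
  ultimately have "N (Ax v) = M\<^sup>2" by simp
  then have attained: "sqrt (N (Ax v)) = M" using M0 by simp
  have bound: "sqrt (N (Ax x)) \<le> M" if "N x = 1" for x
  proof -
    have "N (Ax x) \<le> M * M"
      using AxM[of x] mult_left_mono[OF rayleigh[of x] M0] that by simp
    then show ?thesis using M0 by (intro real_le_lsqrt) (auto simp: power2_eq_square N_def intro: sum_nonneg)
  qed
  have "spec_norm n A = Sup {sqrt (N (Ax x)) | x. N x = 1}"
    by (simp add: spec_norm_def N_def Ax_def)
  also have "\<dots> = M"
    by (rule cSup_eq_maximum) (use attained Nv bound in \<open>blast+\<close>)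
  finally have M: "spec_norm n A = M" .
  show ?thesis
    by (rule that[OF T, of l]) (use l l0 lM p Mpos trace_rotation[OF T _ l] in
      \<open>auto simp: M quad_form_eq_qform mat_trace_def\<close>)
qed

section \<open>Rotation invariance of the standard Gaussian measure\<close>

abbreviation std_gauss :: "real measure" where
  "std_gauss \<equiv> density lborel std_normal_density"

interpretation gauss: prob_space std_gauss
  by (rule prob_space_normal_density) simp

interpretation gauss_prod: product_sigma_finite "\<lambda>_. std_gauss"
  by unfold_locales

text \<open>Since s is nonzero, the rotation factors into two one-dimensional affine substitutions:
  u = c x - s y for fixed x, then v = (x - c u) / s for fixed u.\<close>
lemma lborel_pair_rotation:
  fixes h :: "real \<Rightarrow> real \<Rightarrow> ennreal"
  assumes h[measurable]: "case_prod h \<in> borel_measurable (borel \<Otimes>\<^sub>M borel)"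
    and cs: "c\<^sup>2 + s\<^sup>2 = 1" "s \<noteq> 0"
  shows "(\<integral>\<^sup>+x. \<integral>\<^sup>+y. h (c * x - s * y) (s * x + c * y) \<partial>lborel \<partial>lborel) = (\<integral>\<^sup>+x. \<integral>\<^sup>+y. h x y \<partial>lborel \<partial>lborel)"
proof -
  have hm[measurable]: "(\<lambda>x. h (f x) (g x)) \<in> borel_measurable M"
    if [measurable]: "f \<in> borel_measurable M" "g \<in> borel_measurable M" for f g and M :: "'b measure"
    using measurable_compose[OF measurable_Pair[OF that] h] by simp
  \<comment> \<open>After u = c x - s y the second rotated coordinate s x + c y equals (x - c u) /
    s.\<close>
  have alg: "(x - c * (c * x + - s * y)) / s = s * x + c * y" for x y
  proof -
    have "x - c * (c * x + - s * y) = (c\<^sup>2 + s\<^sup>2) * x - c * (c * x + - s * y)" using cs by simp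
    also have "\<dots> = s * (s * x + c * y)" by (simp add: algebra_simps power2_eq_square)
    finally show ?thesis using cs by simp
  qed
  \<comment> \<open>Both substitutions have Jacobian |s|. Carrying the factor on both sides leaves a
    single cancellation at the end.\<close>
  have "ennreal \<bar>s\<bar> * (\<integral>\<^sup>+x. \<integral>\<^sup>+y. h (c * x - s * y) (s * x + c * y) \<partial>lborel \<partial>lborel)
      = (\<integral>\<^sup>+x. ennreal \<bar>s\<bar> * (\<integral>\<^sup>+y. h (c * x - s * y) (s * x + c * y) \<partial>lborel) \<partial>lborel)"
    by (rule nn_integral_cmult[symmetric]) measurable
  also have "\<dots> = (\<integral>\<^sup>+x. \<integral>\<^sup>+u. h u ((x - c * u) / s) \<partial>lborel \<partial>lborel)"
  proof (rule nn_integral_cong)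
    fix x
    have "(\<integral>\<^sup>+u. h u ((x - c * u) / s) \<partial>lborel)
      = ennreal \<bar>-s\<bar> * (\<integral>\<^sup>+y. h (c * x + - s * y) ((x - c * (c * x + - s * y)) / s) \<partial>lborel)"
      by (rule nn_integral_real_affine) (use cs in auto)
    then show "ennreal \<bar>s\<bar> * (\<integral>\<^sup>+y. h (c * x - s * y) (s * x + c * y) \<partial>lborel)
      = (\<integral>\<^sup>+u. h u ((x - c * u) / s) \<partial>lborel)"
      unfolding alg by simp
  qed
  also have "\<dots> = (\<integral>\<^sup>+u. \<integral>\<^sup>+x. h u ((x - c * u) / s) \<partial>lborel \<partial>lborel)"
    by (rule lborel_pair.Fubini') measurable
  also have "\<dots> = (\<integral>\<^sup>+u. ennreal \<bar>s\<bar> * (\<integral>\<^sup>+v. h u v \<partial>lborel) \<partial>lborel)"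
  proof (rule nn_integral_cong)
    fix u
    have "(\<integral>\<^sup>+x. h u ((x - c * u) / s) \<partial>lborel)
      = ennreal \<bar>s\<bar> * (\<integral>\<^sup>+v. h u ((c * u + s * v - c * u) / s) \<partial>lborel)"
      by (rule nn_integral_real_affine) (use cs in auto)
    then show "(\<integral>\<^sup>+x. h u ((x - c * u) / s) \<partial>lborel) = ennreal \<bar>s\<bar> * (\<integral>\<^sup>+v. h u v \<partial>lborel)"
      using cs by simp
  qed
  also have "\<dots> = ennreal \<bar>s\<bar> * (\<integral>\<^sup>+u. \<integral>\<^sup>+v. h u v \<partial>lborel \<partial>lborel)"
    by (rule nn_integral_cmult) measurable
  finally show ?thesis
    using cs by (simp add: ennreal_mult_cancel_left)
qed

text \<open>The joint density depends on x^2 + y^2 only, so it can be absorbed into the rotated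
  integrand, and the invariance of Lebesgue measure applies to the product.\<close>

lemma std_gauss_pair_rotation:
  fixes h :: "real \<Rightarrow> real \<Rightarrow> ennreal"
  assumes h[measurable]: "case_prod h \<in> borel_measurable (borel \<Otimes>\<^sub>M borel)"
    and cs: "c\<^sup>2 + s\<^sup>2 = 1" "s \<noteq> 0"
  shows "(\<integral>\<^sup>+x. \<integral>\<^sup>+y. h (c * x - s * y) (s * x + c * y) \<partial>std_gauss \<partial>std_gauss)
    = (\<integral>\<^sup>+x. \<integral>\<^sup>+y. h x y \<partial>std_gauss \<partial>std_gauss)"
proof -
  have hm[measurable]: "(\<lambda>x. h (f x) (g x)) \<in> borel_measurable M"
    if [measurable]: "f \<in> borel_measurable M" "g \<in> borel_measurable M" for f g and M :: "'b measure"
    using measurable_compose[OF measurable_Pair[OF that] h] by simp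
  define \<phi> where "\<phi> x y = ennreal (std_normal_density x * std_normal_density y)" for x y
  have dens: "(\<integral>\<^sup>+x. \<integral>\<^sup>+y. g x y \<partial>std_gauss \<partial>std_gauss) = (\<integral>\<^sup>+x. \<integral>\<^sup>+y. \<phi> x y * g x y \<partial>lborel \<partial>lborel)"
    if g: "case_prod g \<in> borel_measurable (borel \<Otimes>\<^sub>M borel)" for g :: "real \<Rightarrow> real \<Rightarrow> ennreal"
  proof -
    have gm[measurable]: "(\<lambda>x. g (f x) (k x)) \<in> borel_measurable M"
      if [measurable]: "f \<in> borel_measurable M" "k \<in> borel_measurable M" for f k and M :: "'b measure"
      using measurable_compose[OF measurable_Pair[OF that] g] by simp
    have "(\<integral>\<^sup>+x. \<integral>\<^sup>+y. g x y \<partial>std_gauss \<partial>std_gauss) =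
        (\<integral>\<^sup>+x. ennreal (std_normal_density x) * (\<integral>\<^sup>+y. ennreal (std_normal_density y) * g x y \<partial>lborel) \<partial>lborel)"
      by (subst nn_integral_density; (measurable)?) (simp add: nn_integral_density)
    also have "\<dots> = (\<integral>\<^sup>+x. \<integral>\<^sup>+y. \<phi> x y * g x y \<partial>lborel \<partial>lborel)"
      by (simp add: nn_integral_cmult[symmetric] \<phi>_def ennreal_mult mult.assoc)
    finally show ?thesis .
  qed
  have inv: "\<phi> (c * x - s * y) (s * x + c * y) = \<phi> x y" for x y
  proof -
    have "(c * x - s * y)\<^sup>2 + (s * x + c * y)\<^sup>2 = (c\<^sup>2 + s\<^sup>2) * (x\<^sup>2 + y\<^sup>2)"
      by (simp add: power2_eq_square algebra_simps)
    then show ?thesis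
      using cs by (simp add: \<phi>_def std_normal_density_def exp_add[symmetric] add_divide_distrib[symmetric])
  qed
  have "(\<integral>\<^sup>+x. \<integral>\<^sup>+y. h (c * x - s * y) (s * x + c * y) \<partial>std_gauss \<partial>std_gauss)
    = (\<integral>\<^sup>+x. \<integral>\<^sup>+y. \<phi> (c * x - s * y) (s * x + c * y) * h (c * x - s * y) (s * x + c * y) \<partial>lborel \<partial>lborel)"
    unfolding inv by (rule dens) measurable
  also have "\<dots> = (\<integral>\<^sup>+x. \<integral>\<^sup>+y. \<phi> x y * h x y \<partial>lborel \<partial>lborel)"
    by (rule lborel_pair_rotation[where h = "\<lambda>x y. \<phi> x y * h x y"]) (unfold \<phi>_def, measurable, fact+)
  also have "\<dots> = (\<integral>\<^sup>+x. \<integral>\<^sup>+y. h x y \<partial>std_gauss \<partial>std_gauss)"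
    by (rule dens[symmetric]) measurable
  finally show ?thesis .
qed

lemma measurable_givens:
  assumes "i \<in> I" "k \<in> I"
  shows "givens i k c s \<in> PiM I (\<lambda>_. std_gauss) \<rightarrow>\<^sub>M PiM I (\<lambda>_. std_gauss)"
proof (rule measurable_PiM_single')
  have [measurable]: "(\<lambda>x. x j) \<in> borel_measurable (PiM I (\<lambda>_. std_gauss))" if "j \<in> I" for j
    using measurable_component_singleton[OF that, of "\<lambda>_. std_gauss"] by simp
  show "(\<lambda>x. givens i k c s x j) \<in> PiM I (\<lambda>_. std_gauss) \<rightarrow>\<^sub>M std_gauss" if "j \<in> I" for j
    using assms that by (cases "j = k"; cases "j = i") (simp_all add: givens_def)
  show "(\<lambda>x a. givens i k c s x a) \<in> space (PiM I (\<lambda>_. std_gauss)) \<rightarrow> I \<rightarrow>\<^sub>E space std_gauss"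
    using assms by (auto simp: space_PiM givens_def PiE_iff extensional_def)
qed

text \<open>Fubini isolates the coordinates \<open>i\<close> and \<open>k\<close>. Integrating out
  the others leaves a function \<open>H\<close> of two variables, for which the planar case
  holds.\<close>

lemma nn_integral_givens:
  assumes "finite I" "i \<in> I" "k \<in> I" "i \<noteq> k" "c\<^sup>2 + s\<^sup>2 = 1" "s \<noteq> 0"
    and f[measurable]: "f \<in> borel_measurable (PiM I (\<lambda>_. std_gauss))"
  shows "(\<integral>\<^sup>+x. f (givens i k c s x) \<partial>PiM I (\<lambda>_. std_gauss)) = (\<integral>\<^sup>+x. f x \<partial>PiM I (\<lambda>_. std_gauss))"
proof -
  define J where "J = I - {i, k}"
  have J: "finite J" "k \<notin> J" "i \<notin> insert k J" and I: "I = insert i (insert k J)"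
    using assms by (auto simp: J_def)
  have expand: "(\<integral>\<^sup>+x. g x \<partial>PiM I (\<lambda>_. std_gauss)) =
      (\<integral>\<^sup>+y. \<integral>\<^sup>+w. \<integral>\<^sup>+x. g (x(k := w, i := y)) \<partial>PiM J (\<lambda>_. std_gauss) \<partial>std_gauss \<partial>std_gauss)"
    if g[measurable]: "g \<in> borel_measurable (PiM I (\<lambda>_. std_gauss))" for g
  proof -
    have "(\<integral>\<^sup>+x. g x \<partial>PiM I (\<lambda>_. std_gauss)) =
        (\<integral>\<^sup>+y. \<integral>\<^sup>+x. g (x(i := y)) \<partial>PiM (insert k J) (\<lambda>_. std_gauss) \<partial>std_gauss)"
      unfolding I by (rule gauss_prod.product_nn_integral_insert_rev) (use J g in \<open>auto simp: I\<close>)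
    also have "\<dots> = (\<integral>\<^sup>+y. \<integral>\<^sup>+w. \<integral>\<^sup>+x. g (x(k := w, i := y)) \<partial>PiM J (\<lambda>_. std_gauss) \<partial>std_gauss \<partial>std_gauss)"
    proof (rule nn_integral_cong)
      fix y
      have "(\<lambda>x. x(i := y)) \<in> PiM (insert k J) (\<lambda>_. std_gauss) \<rightarrow>\<^sub>M PiM I (\<lambda>_. std_gauss)"
        unfolding I by (rule measurable_fun_upd[where J = "insert k J"]) auto
      then have "(\<lambda>x. g (x(i := y))) \<in> borel_measurable (PiM (insert k J) (\<lambda>_. std_gauss))"
        using g by measurable
      then show "(\<integral>\<^sup>+x. g (x(i := y)) \<partial>PiM (insert k J) (\<lambda>_. std_gauss))
        = (\<integral>\<^sup>+w. \<integral>\<^sup>+x. g (x(k := w, i := y)) \<partial>PiM J (\<lambda>_. std_gauss) \<partial>std_gauss)"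
        using gauss_prod.product_nn_integral_insert_rev[OF J(1,2), of "\<lambda>x. g (x(i := y))"] by simp
    qed
    finally show ?thesis .
  qed
  define H where "H y w = (\<integral>\<^sup>+x. f (x(k := w, i := y)) \<partial>PiM J (\<lambda>_. std_gauss))" for y w
  have upd: "(\<lambda>p. (snd p)(k := snd (fst p), i := fst (fst p)))
     \<in> (borel \<Otimes>\<^sub>M borel) \<Otimes>\<^sub>M PiM J (\<lambda>_. std_gauss) \<rightarrow>\<^sub>M PiM I (\<lambda>_. std_gauss)"
    unfolding I
    by (rule measurable_fun_upd[where J = "insert k J"], simp, rule measurable_fun_upd[where J = J]) auto
  interpret SJ: sigma_finite_measure "PiM J (\<lambda>_. std_gauss)"
    by (rule gauss_prod.sigma_finite) (rule J)
  have "(\<lambda>p. f ((snd p)(k := snd (fst p), i := fst (fst p))))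
     \<in> borel_measurable ((borel \<Otimes>\<^sub>M borel) \<Otimes>\<^sub>M PiM J (\<lambda>_. std_gauss))"
    by (rule measurable_compose[OF upd f])
  then have H: "case_prod H \<in> borel_measurable (borel \<Otimes>\<^sub>M borel)"
    using SJ.borel_measurable_nn_integral[of "\<lambda>p x. f (x(k := snd p, i := fst p))" "borel \<Otimes>\<^sub>M borel"]
    unfolding H_def by (simp add: case_prod_unfold)
  have Gm: "(\<lambda>x. f (givens i k c s x)) \<in> borel_measurable (PiM I (\<lambda>_. std_gauss))"
    by (rule measurable_compose[OF measurable_givens f]) (use assms in auto)
  have upd_givens: "givens i k c s (x(k := w, i := y)) = x(k := s * y + c * w, i := c * y - s * w)" for x w y
    using \<open>i \<noteq> k\<close> by (auto simp: givens_def)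
  have "(\<integral>\<^sup>+x. f (givens i k c s x) \<partial>PiM I (\<lambda>_. std_gauss))
    = (\<integral>\<^sup>+y. \<integral>\<^sup>+w. H (c * y - s * w) (s * y + c * w) \<partial>std_gauss \<partial>std_gauss)"
    unfolding expand[OF Gm] upd_givens H_def ..
  also have "\<dots> = (\<integral>\<^sup>+y. \<integral>\<^sup>+w. H y w \<partial>std_gauss \<partial>std_gauss)"
    by (rule std_gauss_pair_rotation[OF H]) fact+
  also have "\<dots> = (\<integral>\<^sup>+x. f x \<partial>PiM I (\<lambda>_. std_gauss))"
    unfolding expand[OF f] H_def ..
  finally show ?thesis .
qed

lemma rotation_invariance:
  assumes "T \<in> rotations I" "finite I"
  shows "T \<in> PiM I (\<lambda>_. std_gauss) \<rightarrow>\<^sub>M PiM I (\<lambda>_. std_gauss)"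
    and "distr (PiM I (\<lambda>_. std_gauss)) (PiM I (\<lambda>_. std_gauss)) T = PiM I (\<lambda>_. std_gauss)"
proof -
  let ?P = "PiM I (\<lambda>_. std_gauss)"
  \<comment> \<open>Invariance passes through the induction as an equality of integrals: one more
    rotation is handled by applying the hypothesis to f composed with that rotation.\<close>
  have "T \<in> ?P \<rightarrow>\<^sub>M ?P \<and> (\<forall>f\<in>borel_measurable ?P. (\<integral>\<^sup>+x. f (T x) \<partial>?P) = (\<integral>\<^sup>+x. f x \<partial>?P))"
    using assms(1)
  proof induction
    case (rotations_step T i k c s)
    note G = measurable_givens[OF rotations_step.hyps(2,3)]
    have "(\<integral>\<^sup>+x. f (givens i k c s (T x)) \<partial>?P) = (\<integral>\<^sup>+x. f x \<partial>?P)" if f: "f \<in> borel_measurable ?P" for f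
    proof -
      have "(\<lambda>x. f (givens i k c s x)) \<in> borel_measurable ?P"
        by (rule measurable_compose[OF G f])
      then have "(\<integral>\<^sup>+x. f (givens i k c s (T x)) \<partial>?P) = (\<integral>\<^sup>+x. f (givens i k c s x) \<partial>?P)"
        using rotations_step.IH by auto
      then show ?thesis
        using nn_integral_givens[OF assms(2) rotations_step.hyps(2-6) f] by simp
    qed
    moreover have "(\<lambda>x. givens i k c s (T x)) \<in> ?P \<rightarrow>\<^sub>M ?P"
      by (rule measurable_compose[OF _ G]) (use rotations_step.IH in blast)
    ultimately show ?case by blast
  qed simp
  then have m: "T \<in> ?P \<rightarrow>\<^sub>M ?P"
    and i: "\<And>f. f \<in> borel_measurable ?P \<Longrightarrow> (\<integral>\<^sup>+x. f (T x) \<partial>?P) = (\<integral>\<^sup>+x. f x \<partial>?P)" by auto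
  show "T \<in> ?P \<rightarrow>\<^sub>M ?P" by fact
  show "distr ?P ?P T = ?P"
  proof (rule measure_eqI)
    fix B assume "B \<in> sets (distr ?P ?P T)"
    then have B: "B \<in> sets ?P" by simp
    have "emeasure (distr ?P ?P T) B = (\<integral>\<^sup>+x. indicator B x \<partial>distr ?P ?P T)" using B by simp
    also have "\<dots> = (\<integral>\<^sup>+x. indicator B (T x) \<partial>?P)"
      by (rule nn_integral_distr[OF m]) (use B in simp)
    also have "\<dots> = emeasure ?P B" using i[of "indicator B"] B by simp
    finally show "emeasure (distr ?P ?P T) B = emeasure ?P B" .
  qed simp
qed

text \<open>All samples are rotated by the same \<open>T\<close> at once, and this has to be again a
  product of plane rotations, now on pairs of indices. For one plane rotation this follows by
  treating the rows one after the other, whence the inner induction on \<open>K\<close>.\<close>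

lemma rotations_rows:
  fixes K :: "'b set"
  assumes "T \<in> rotations I" "finite K"
  shows "(\<lambda>z p. if fst p \<in> K then T (\<lambda>i. z (fst p, i)) (snd p) else z p) \<in> rotations (K \<times> I)"
  using assms(1)
proof induction
  case rotations_id
  have "(\<lambda>z p. if fst p \<in> K then z (fst p, snd p) else z p) = (\<lambda>z :: 'b \<times> 'a \<Rightarrow> real. z)"
    by (intro ext) simp
  then show ?case by (simp only: rotations.rotations_id)
next
  case (rotations_step T i k c s)
  have "(\<lambda>z p. if fst p \<in> K then givens i k c s (\<lambda>i. z (fst p, i)) (snd p) else z p) \<in> rotations (K \<times> I)"
    using assms(2)
  proof (induction K rule: finite_induct)
    case empty
    then show ?case by (simp add: rotations.rotations_id)
  next
    case (insert j K)
    let ?G = "\<lambda>z p. if fst p \<in> K then givens i k c s (\<lambda>i. z (fst p, i)) (snd p) else z p"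
    have G: "?G \<in> rotations (insert j K \<times> I)" by (rule rotations_mono[OF insert.IH]) auto
    have "(\<lambda>z p. if fst p \<in> insert j K then givens i k c s (\<lambda>i. z (fst p, i)) (snd p) else z p)
      = (\<lambda>z. givens (j, i) (j, k) c s (?G z))"
      using insert.hyps \<open>i \<noteq> k\<close> by (intro ext) (auto simp: givens_def)
    also have "\<dots> \<in> rotations (insert j K \<times> I)"
      by (rule rotations.rotations_step[OF G]) (use rotations_step.hyps in auto)
    finally show ?case .
  qed
  from rotations_comp[OF this rotations_step.IH] show ?case
    by (rule back_subst[where P = "\<lambda>U. U \<in> rotations (K \<times> I)"]) (intro ext, simp)
qed

section \<open>Gamma distributions\<close>

lemma gamma_density_measurable [measurable]: "gamma_density a b \<in> borel_measurable borel"
  unfolding gamma_density_def[abs_def] by measurable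

lemma gamma_density_nonneg: "a > 0 \<Longrightarrow> 0 \<le> gamma_density a b x"
  by (simp add: gamma_density_def Gamma_real_pos less_imp_le)

lemma sets_gamma_measure [simp, measurable_cong]: "sets (gamma_measure a b) = sets borel"
  and space_gamma_measure [simp]: "space (gamma_measure a b) = UNIV"
  by (simp_all add: gamma_measure_def)

lemma gamma_density_scale:
  assumes "c > 0" "b > 0"
  shows "gamma_density a b (x / c) = c * gamma_density a (b / c) x"
proof (cases "x > 0")
  case True
  have "b powr a = (b / c) powr a * c powr a" "x powr (a - 1) = (x / c) powr (a - 1) * c powr (a - 1)"
    using True assms by (simp_all add: powr_mult[symmetric])
  moreover have "c powr a = c powr (a - 1) * c"
    using powr_mult_base[of c "a - 1"] assms by (simp add: mult.commute)
  ultimately show ?thesis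
    using True assms by (simp add: gamma_density_def field_simps)
next
  case False
  then have "\<not> 0 < x / c" using assms by (simp add: zero_less_divide_iff)
  then show ?thesis using False by (simp add: gamma_density_def)
qed

lemma emeasure_gamma_scale:
  assumes "c > 0" "b > 0"
  shows "emeasure (gamma_measure a b) {t..} = emeasure (gamma_measure a (b / c)) {c * t..}"
proof -
  have "emeasure (gamma_measure a b) {t..} = (\<integral>\<^sup>+x. ennreal (gamma_density a b x) * indicator {t..} x \<partial>lborel)"
    unfolding gamma_measure_def by (subst emeasure_density) auto
  also have "\<dots> = ennreal \<bar>1 / c\<bar> *
      (\<integral>\<^sup>+x. ennreal (gamma_density a b (0 + 1 / c * x)) * indicator {t..} (0 + 1 / c * x) \<partial>lborel)"
    by (rule nn_integral_real_affine) (use assms in auto)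
  also have "\<dots> = (\<integral>\<^sup>+x. ennreal (1 / c) *
      (ennreal (gamma_density a b (0 + 1 / c * x)) * indicator {t..} (0 + 1 / c * x)) \<partial>lborel)"
    using assms by (subst nn_integral_cmult) auto
  also have "\<dots> = (\<integral>\<^sup>+x. ennreal (gamma_density a (b / c) x) * indicator {c * t..} x \<partial>lborel)"
  proof (rule nn_integral_cong)
    fix x
    have "ennreal (1 / c) * ennreal (gamma_density a b (x / c)) = ennreal (gamma_density a (b / c) x)"
      using assms unfolding gamma_density_scale[OF assms]
      by (subst ennreal_mult'[symmetric]) auto
    moreover have "indicator {t..} (x / c) = (indicator {c * t..} x :: ennreal)"
      using assms by (simp add: indicator_def field_simps)
    ultimately show "ennreal (1 / c) * (ennreal (gamma_density a b (0 + 1 / c * x)) * indicator {t..} (0 + 1 / c * x))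
      = ennreal (gamma_density a (b / c) x) * indicator {c * t..} x"
      by (simp add: mult.assoc[symmetric])
  qed
  also have "\<dots> = emeasure (gamma_measure a (b / c)) {c * t..}"
    unfolding gamma_measure_def by (subst emeasure_density) auto
  finally show ?thesis .
qed

lemma emeasure_gamma_pos_part:
  "emeasure (gamma_measure a b) {0..} = emeasure (gamma_measure a b) UNIV"
  unfolding gamma_measure_def
  by (simp add: emeasure_density) (rule nn_integral_cong, simp add: gamma_density_def indicator_def)

lemma real_distribution_gamma:
  assumes "a > 0" "b > 0"
  shows "real_distribution (gamma_measure a b)"
proof -
  \<comment> \<open>Scaling by \<open>b\<close> with threshold 0 reduces the total mass to rate 1,
    where it is Euler's integral.\<close>
  have "emeasure (gamma_measure a b) UNIV = emeasure (gamma_measure a 1) {0..}"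
    using emeasure_gamma_scale[of b b a 0] assms by (simp add: emeasure_gamma_pos_part)
  also have "\<dots> = (\<integral>\<^sup>+x. ennreal (gamma_density a 1 x) * indicator {0..} x \<partial>lborel)"
    unfolding gamma_measure_def by (subst emeasure_density) auto
  also have "\<dots> = (\<integral>\<^sup>+x. ennreal (1 / Gamma a) * ennreal (indicator {0..} x * x powr (a - 1) / exp x) \<partial>lborel)"
    by (intro nn_integral_cong)
       (use assms in \<open>auto simp: gamma_density_def indicator_def exp_minus Gamma_real_pos less_imp_le
          ennreal_mult'[symmetric] field_simps\<close>)
  also have "\<dots> = ennreal (1 / Gamma a) * ennreal (Gamma a)"
    unfolding Gamma_conv_nn_integral_real[OF assms(1)] by (rule nn_integral_cmult) measurable
  also have "\<dots> = 1"
    using Gamma_real_pos[OF assms(1)] by (subst ennreal_mult[symmetric]) (auto simp: less_imp_le)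
  finally have "prob_space (gamma_measure a b)" by (intro prob_spaceI) simp
  then show ?thesis by (simp add: real_distribution_def real_distribution_axioms_def)
qed

text \<open>Substituting y = x u turns the convolution into x-dependent factors times a Beta
  integral, whose value replaces the two Gamma constants by \<open>Gamma (a + c)\<close>.\<close>

lemma gamma_convolution:
  assumes "a > 0" "c > 0" "b > 0"
  shows "gamma_measure a b \<star> gamma_measure c b = gamma_measure (a + c) b"
proof -
  have fin: "finite_measure (density lborel (gamma_density e b))" if "e > 0" for e
    using real_distribution_gamma[OF that assms(3)]
    unfolding real_distribution_def prob_space_def gamma_measure_def by blast
  have "gamma_measure a b \<star> gamma_measure c b
    = density lborel (\<lambda>x. \<integral>\<^sup>+y. ennreal (gamma_density a b (x - y)) * ennreal (gamma_density c b y) \<partial>lborel)"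
    unfolding gamma_measure_def
    by (rule convolution_density) (auto intro: fin assms)
  also have "\<dots> = density lborel (gamma_density (a + c) b)"
  proof (rule density_cong)
    show "AE x in lborel. (\<integral>\<^sup>+y. ennreal (gamma_density a b (x - y)) * ennreal (gamma_density c b y) \<partial>lborel)
       = ennreal (gamma_density (a + c) b x)"
    proof (rule AE_I2)
      fix x :: real
      show "(\<integral>\<^sup>+y. ennreal (gamma_density a b (x - y)) * ennreal (gamma_density c b y) \<partial>lborel)
        = ennreal (gamma_density (a + c) b x)"
      proof (cases "x > 0")
        case False
        then have *: "ennreal (gamma_density a b (x - y)) * ennreal (gamma_density c b y) = 0" for y
          by (auto simp: gamma_density_def)
        show ?thesis unfolding * using False by (simp add: gamma_density_def)
      next
        case True
        define D where "D = b powr (a + c) * x powr (a + c - 1) * exp (- b * x) / (Gamma a * Gamma c)"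
        have D: "D \<ge> 0" unfolding D_def using assms by (simp add: Gamma_real_pos less_imp_le)
        have "(\<integral>\<^sup>+y. ennreal (gamma_density a b (x - y)) * ennreal (gamma_density c b y) \<partial>lborel)
          = ennreal \<bar>x\<bar> * (\<integral>\<^sup>+u. ennreal (gamma_density a b (x - (0 + x * u))) * ennreal (gamma_density c b (0 + x * u)) \<partial>lborel)"
          by (rule nn_integral_real_affine) (use True in auto)
        also have "\<dots> = (\<integral>\<^sup>+u. ennreal x * (ennreal (gamma_density a b (x - (0 + x * u))) * ennreal (gamma_density c b (0 + x * u))) \<partial>lborel)"
          using True by (subst nn_integral_cmult) auto
        also have "\<dots> = (\<integral>\<^sup>+u. ennreal D * (ennreal (u powr (c - 1) * (1 - u) powr (a - 1)) * indicator {0..1} u) \<partial>lborel)"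
        proof (rule nn_integral_cong_AE)
          \<comment> \<open>The densities are cut off at strict positivity, the Beta integrand at a
            closed interval; the two endpoints form a null set.\<close>
          have "AE u in lborel. u \<noteq> 0 \<and> u \<noteq> (1::real)"
            using AE_lborel_singleton[of 0] AE_lborel_singleton[of 1] by auto
          then show "AE u in lborel.
             ennreal x * (ennreal (gamma_density a b (x - (0 + x * u))) * ennreal (gamma_density c b (0 + x * u)))
             = ennreal D * (ennreal (u powr (c - 1) * (1 - u) powr (a - 1)) * indicator {0..1} u)"
          proof eventually_elim
            case (elim u)
            show ?case
            proof (cases "0 < u \<and> u < 1")
              case False
              then have "\<not> 0 < x * u \<or> \<not> 0 < x - x * u" using True elim
                by (auto simp: mult_less_0_iff zero_less_mult_iff algebra_simps)
              moreover have "u \<notin> {0..1}" using False elim by auto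
              ultimately show ?thesis by (auto simp: gamma_density_def)
            next
              case u: True
              then have pos: "0 < x * u" "0 < x - x * u" using True by auto
              have "x - x * u = x * (1 - u)" by (simp add: algebra_simps)
              then have p1: "(x - x * u) powr (a - 1) = x powr (a - 1) * (1 - u) powr (a - 1)"
                using True u by (simp add: powr_mult)
              have p2: "(x * u) powr (c - 1) = x powr (c - 1) * u powr (c - 1)"
                using True u by (simp add: powr_mult)
              have p3: "x powr (a + c - 1) = x * x powr (a - 1) * x powr (c - 1)"
              proof -
                have "x * (x powr (a - 1) * x powr (c - 1)) = x powr (1 + ((a - 1) + (c - 1)))"
                  unfolding powr_add[of x "a - 1" "c - 1", symmetric]
                  using True by (intro powr_mult_base) simp
                then show ?thesis by (simp add: algebra_simps)
              qed
              have p4: "exp (- b * (x - x * u)) * exp (- b * (x * u)) = exp (- b * x)"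
                unfolding exp_add[symmetric] by (simp add: algebra_simps)
              have p5: "b powr (a + c) = b powr a * b powr c" by (rule powr_add)
              have "x * (gamma_density a b (x - x * u) * gamma_density c b (x * u))
                 = D * (u powr (c - 1) * (1 - u) powr (a - 1))"
                using pos unfolding gamma_density_def D_def p1 p2 p3 p5 p4[symmetric] by (simp add: mult_ac)
              then have "ennreal x * (ennreal (gamma_density a b (x - x * u)) * ennreal (gamma_density c b (x * u)))
                 = ennreal D * ennreal (u powr (c - 1) * (1 - u) powr (a - 1))"
                using True assms D
                by (simp add: ennreal_mult[symmetric] gamma_density_nonneg)
              then show ?thesis using u by simp
            qed
          qed
        qed
        also have "\<dots> = ennreal D * (\<integral>\<^sup>+u. ennreal (u powr (c - 1) * (1 - u) powr (a - 1)) * indicator {0..1} u \<partial>lborel)"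
          by (rule nn_integral_cmult) measurable
        also have "\<dots> = ennreal D * ennreal (Beta c a)"
          using assms by (subst nn_integral_has_integral_lebesgue'[OF _ has_integral_Beta_real]) auto
        also have "\<dots> = ennreal (gamma_density (a + c) b x)"
        proof -
          have G: "Gamma a > 0" "Gamma c > 0" "Gamma (a + c) > 0"
            using assms by (auto intro: Gamma_real_pos)
          have "Beta c a \<ge> 0" using G by (simp add: Beta_def add.commute)
          moreover have "D * Beta c a = gamma_density (a + c) b x"
            using G True by (simp add: D_def Beta_def gamma_density_def add.commute)
          ultimately show ?thesis using D by (simp add: ennreal_mult[symmetric])
        qed
        finally show ?thesis .
      qed
    qed
  qed measurable
  finally show ?thesis by (simp add: gamma_measure_def)
qed

section \<open>Weighted sums of squares of Gaussians\<close>

text \<open>The law of a weighted sum of independent chi-squares with one degree of freedom.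
  Arbitrary index sets allow splitting by weight; the estimators use pairs of a sample and an
  eigenvalue.\<close>

definition chi_mix :: "'a set \<Rightarrow> ('a \<Rightarrow> real) \<Rightarrow> real measure" where
  "chi_mix I w = distr (PiM I (\<lambda>_. std_gauss)) borel (\<lambda>z. \<Sum>i\<in>I. w i * (z i)\<^sup>2)"

lemma measurable_gauss_component:
  assumes "i \<in> I"
  shows "(\<lambda>z. z i) \<in> borel_measurable (PiM I (\<lambda>_. std_gauss))"
  using measurable_component_singleton[OF assms, of "\<lambda>_. std_gauss"] by simp

lemma measurable_sum_squares:
  assumes "J \<subseteq> I"
  shows "(\<lambda>z. \<Sum>i\<in>J. w i * (z i)\<^sup>2) \<in> borel_measurable (PiM I (\<lambda>_. std_gauss))"
  using assms
  by (intro borel_measurable_sum borel_measurable_times borel_measurable_power borel_measurable_const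
      measurable_gauss_component) auto

lemma prob_space_gauss_product: "prob_space (PiM I (\<lambda>_. std_gauss))"
  by (rule prob_space_PiM) unfold_locales

lemma real_distribution_chi_mix: "real_distribution (chi_mix I w)"
  unfolding chi_mix_def
  by (rule prob_space.real_distribution_distr[OF prob_space_gauss_product measurable_sum_squares]) simp

lemma sets_chi_mix [simp, measurable_cong]: "sets (chi_mix I w) = sets borel"
  and space_chi_mix [simp]: "space (chi_mix I w) = UNIV"
  by (simp_all add: chi_mix_def)

lemma chi_mix_cong: "(\<And>i. i \<in> I \<Longrightarrow> v i = w i) \<Longrightarrow> chi_mix I v = chi_mix I w"
  unfolding chi_mix_def by (simp cong: sum.cong)

text \<open>Coordinates over disjoint index sets are independent: \<open>merge\<close> carries the
  product of the two product measures to the one over the union.\<close>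

lemma chi_mix_union:
  assumes "finite I" "finite J" "I \<inter> J = {}"
  shows "chi_mix (I \<union> J) w = (chi_mix I w \<star> chi_mix J w)"
proof -
  let ?P = "\<lambda>I. PiM I (\<lambda>_. std_gauss)"
  let ?f = "\<lambda>I z. \<Sum>i\<in>I. w i * (z i)\<^sup>2"
  interpret J: real_distribution "chi_mix J w" by (rule real_distribution_chi_mix)
  have fm: "?f I \<in> borel_measurable (?P I)" for I :: "'a set" by (rule measurable_sum_squares) simp
  have "chi_mix I w \<star> chi_mix J w
     = distr (distr (?P I \<Otimes>\<^sub>M ?P J) (borel \<Otimes>\<^sub>M borel) (\<lambda>(x, y). (?f I x, ?f J y))) borel (\<lambda>(x, y). x + y)"
    unfolding convolution_def chi_mix_def
    by (subst pair_measure_distr[OF fm fm])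
       (simp_all add: J.sigma_finite_measure_axioms chi_mix_def[symmetric])
  also have "\<dots> = distr (?P I \<Otimes>\<^sub>M ?P J) borel (\<lambda>(x, y). ?f I x + ?f J y)"
    by (subst distr_distr) (use fm in \<open>auto simp: comp_def case_prod_unfold
        intro!: measurable_Pair measurable_compose[OF measurable_fst fm] measurable_compose[OF measurable_snd fm]\<close>)
  also have "\<dots> = distr (?P I \<Otimes>\<^sub>M ?P J) borel (\<lambda>p. ?f (I \<union> J) (merge I J p))"
  proof (rule distr_cong[OF refl refl])
    fix p :: "('a \<Rightarrow> real) \<times> ('a \<Rightarrow> real)"
    have "?f (I \<union> J) (merge I J p) = ?f I (merge I J p) + ?f J (merge I J p)"
      by (rule sum.union_disjoint) fact+
    also have "?f I (merge I J p) = ?f I (fst p)"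
      by (rule sum.cong) (auto simp: merge_def split: prod.splits)
    also have "?f J (merge I J p) = ?f J (snd p)"
      using assms(3) by (intro sum.cong) (auto simp: merge_def split: prod.splits)
    finally show "(case p of (x, y) \<Rightarrow> ?f I x + ?f J y) = ?f (I \<union> J) (merge I J p)"
      by (simp add: case_prod_unfold)
  qed
  also have "\<dots> = distr (distr (?P I \<Otimes>\<^sub>M ?P J) (?P (I \<union> J)) (merge I J)) borel (?f (I \<union> J))"
    by (subst distr_distr[OF fm measurable_merge]) (simp add: comp_def)
  also have "\<dots> = chi_mix (I \<union> J) w"
    unfolding chi_mix_def by (subst gauss_prod.distr_merge) (use assms in auto)
  finally show ?thesis ..
qed

lemma chi_mix_const:
  "chi_mix I (\<lambda>_. c) = distr (chi_mix I (\<lambda>_. 1)) borel (\<lambda>x. c * x)"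
  unfolding chi_mix_def
  by (subst distr_distr) (auto simp: comp_def sum_distrib_left intro: measurable_sum_squares[of I I "\<lambda>_. 1", simplified])

lemma chi_mix_zero: "(\<And>i. i \<in> I \<Longrightarrow> w i = 0) \<Longrightarrow> chi_mix I w = return borel 0"
  using prob_space.distr_const[OF prob_space_gauss_product, of 0 borel I]
  by (simp add: chi_mix_def)

lemma convolution_return_zero:
  assumes "real_distribution M"
  shows "M \<star> return borel 0 = M"
proof (rule measure_eqI)
  interpret M: real_distribution M by fact
  show "sets (M \<star> return borel 0) = sets M" by simp
  fix A assume "A \<in> sets (M \<star> return borel 0)"
  then have A[measurable]: "A \<in> sets borel" by simp
  have "finite_measure (return borel (0::real))"
    by (intro prob_space.finite_measure prob_space_return) simp
  then have "emeasure (M \<star> return borel 0) A = (\<integral>\<^sup>+x. emeasure (return borel 0) {a. a + x \<in> A} \<partial>M)"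
    by (intro convolution_emeasure) (auto simp: M.finite_measure_axioms)
  also have "\<dots> = (\<integral>\<^sup>+x. indicator A x \<partial>M)"
  proof (rule nn_integral_cong)
    fix x
    have "{a. a + x \<in> A} \<in> sets borel"
      using measurable_sets[of "\<lambda>a. a + x" borel borel A] A by (simp add: vimage_def)
    then show "emeasure (return borel 0) {a. a + x \<in> A} = indicator A x"
      by (simp add: indicator_def)
  qed
  finally show "emeasure (M \<star> return borel 0) A = emeasure M A" by simp
qed

section \<open>Nonnegativity and exponential moments\<close>

lemma chi_mix_nonneg:
  assumes "\<And>i. i \<in> I \<Longrightarrow> 0 \<le> w i"
  shows "AE x in chi_mix I w. 0 \<le> x"
  unfolding chi_mix_def
  by (subst AE_distr_iff[OF measurable_sum_squares]) (auto intro!: sum_nonneg mult_nonneg_nonneg assms)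

text \<open>The integrand times the standard density is \<open>\<sigma>\<close> times the centred
  normal density of variance 1 / (1 - 2 u), so the integral is \<open>\<sigma>\<close>.\<close>

lemma nn_integral_exp_square:
  assumes "2 * u < 1"
  shows "(\<integral>\<^sup>+z. ennreal (exp (u * z\<^sup>2)) \<partial>std_gauss) = ennreal ((1 - 2 * u) powr (- 1 / 2))"
proof -
  define \<sigma> where "\<sigma> = 1 / sqrt (1 - 2 * u)"
  have \<sigma>: "\<sigma> > 0" using assms by (simp add: \<sigma>_def)
  have "(1 - 2 * u) powr (- 1 / 2) = inverse ((1 - 2 * u) powr (1 / 2))"
    using powr_minus[of "1 - 2 * u" "1/2"] by simp
  then have p: "(1 - 2 * u) powr (- 1 / 2) = \<sigma>"
    using assms by (simp add: \<sigma>_def powr_half_sqrt inverse_eq_divide)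
  have "(\<integral>\<^sup>+z. ennreal (exp (u * z\<^sup>2)) \<partial>std_gauss)
     = (\<integral>\<^sup>+z. ennreal (std_normal_density z) * ennreal (exp (u * z\<^sup>2)) \<partial>lborel)"
    by (rule nn_integral_density) measurable
  also have "\<dots> = (\<integral>\<^sup>+z. ennreal \<sigma> * ennreal (normal_density 0 \<sigma> z) \<partial>lborel)"
  proof (rule nn_integral_cong)
    fix z
    have s2: "\<sigma>\<^sup>2 = 1 / (1 - 2 * u)" using assms by (simp add: \<sigma>_def power_divide)
    have "- z\<^sup>2 / 2 + u * z\<^sup>2 = - z\<^sup>2 / (2 * \<sigma>\<^sup>2)"
      unfolding s2 by (simp add: field_simps)
    then have "std_normal_density z * exp (u * z\<^sup>2) = 1 / sqrt (2 * pi) * exp (- z\<^sup>2 / (2 * \<sigma>\<^sup>2))"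
      by (simp add: std_normal_density_def exp_add[symmetric])
    also have "\<dots> = \<sigma> * normal_density 0 \<sigma> z"
      using \<sigma> by (simp add: normal_density_def real_sqrt_mult)
    finally show "ennreal (std_normal_density z) * ennreal (exp (u * z\<^sup>2))
        = ennreal \<sigma> * ennreal (normal_density 0 \<sigma> z)"
      using \<sigma> by (simp add: ennreal_mult[symmetric])
  qed
  also have "\<dots> = ennreal \<sigma> * (\<integral>\<^sup>+z. ennreal (normal_density 0 \<sigma> z) \<partial>lborel)"
    by (rule nn_integral_cmult) measurable
  also have "(\<integral>\<^sup>+z. ennreal (normal_density 0 \<sigma> z) \<partial>lborel) = 1"
    using prob_space.emeasure_space_1[OF prob_space_normal_density[OF \<sigma>, of 0]]
    by (simp add: emeasure_density)
  finally show ?thesis unfolding p by simp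
qed

lemma nn_integral_exp_chi_mix:
  assumes "finite I" "\<And>i. i \<in> I \<Longrightarrow> 2 * s * w i < 1"
  shows "(\<integral>\<^sup>+x. ennreal (exp (s * x)) \<partial>chi_mix I w) = ennreal (\<Prod>i\<in>I. (1 - 2 * s * w i) powr (- 1 / 2))"
proof -
  have "(\<integral>\<^sup>+x. ennreal (exp (s * x)) \<partial>chi_mix I w)
      = (\<integral>\<^sup>+z. ennreal (exp (s * (\<Sum>i\<in>I. w i * (z i)\<^sup>2))) \<partial>PiM I (\<lambda>_. std_gauss))"
    unfolding chi_mix_def by (rule nn_integral_distr[OF measurable_sum_squares]) auto
  also have "\<dots> = (\<integral>\<^sup>+z. (\<Prod>i\<in>I. ennreal (exp (s * w i * (z i)\<^sup>2))) \<partial>PiM I (\<lambda>_. std_gauss))"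
    using assms(1) by (simp add: sum_distrib_left exp_sum prod_ennreal mult.assoc)
  also have "\<dots> = (\<Prod>i\<in>I. \<integral>\<^sup>+z. ennreal (exp (s * w i * z\<^sup>2)) \<partial>std_gauss)"
    by (rule gauss_prod.product_nn_integral_prod[OF assms(1)]) measurable
  also have "\<dots> = (\<Prod>i\<in>I. ennreal ((1 - 2 * s * w i) powr (- 1 / 2)))"
    by (intro prod.cong refl, subst nn_integral_exp_square) (use assms(2) in \<open>auto simp: mult.assoc\<close>)
  also have "\<dots> = ennreal (\<Prod>i\<in>I. (1 - 2 * s * w i) powr (- 1 / 2))"
    by (rule prod_ennreal) simp
  finally show ?thesis .
qed

lemma exp_integral_chi_mix:
  assumes "finite I" "\<And>i. i \<in> I \<Longrightarrow> 2 * s * w i < 1"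
  shows "integrable (chi_mix I w) (\<lambda>x. exp (s * x))"
    and "(\<integral>x. exp (s * x) \<partial>chi_mix I w) = (\<Prod>i\<in>I. (1 - 2 * s * w i) powr (- 1 / 2))"
proof -
  have "has_bochner_integral (chi_mix I w) (\<lambda>x. exp (s * x)) (\<Prod>i\<in>I. (1 - 2 * s * w i) powr (- 1 / 2))"
    by (rule has_bochner_integral_nn_integral[OF _ _ _ nn_integral_exp_chi_mix[OF assms]])
       (auto intro!: prod_nonneg)
  then show "integrable (chi_mix I w) (\<lambda>x. exp (s * x))"
    and "(\<integral>x. exp (s * x) \<partial>chi_mix I w) = (\<Prod>i\<in>I. (1 - 2 * s * w i) powr (- 1 / 2))"
    by (auto simp: has_bochner_integral_iff)
qed

text \<open>The two halves of the interval contribute equally, and x = z^2 on [0, b] carries twice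
  the normal density to the Gamma density, with \<open>2 * z\<close> as the derivative.\<close>

lemma gauss_square_interval:
  assumes "0 \<le> b"
  shows "emeasure std_gauss {-b..b} = emeasure (gamma_measure (1/2) (1/2)) {..b\<^sup>2}"
proof -
  let ?\<phi> = "\<lambda>z. ennreal (std_normal_density z)"
  have "emeasure std_gauss {-b..b} = (\<integral>\<^sup>+z. ?\<phi> z * indicator {-b..b} z \<partial>lborel)"
    by (rule emeasure_density) auto
  also have "\<dots> = (\<integral>\<^sup>+z. ?\<phi> z * indicator {0..b} z + ?\<phi> z * indicator {-b..0} z \<partial>lborel)"
  proof (rule nn_integral_cong_AE)
    show "AE z in lborel. ?\<phi> z * indicator {-b..b} z = ?\<phi> z * indicator {0..b} z + ?\<phi> z * indicator {-b..0} z"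
      using AE_lborel_singleton[of "0::real"]
      by eventually_elim (auto simp: indicator_def assms)
  qed
  also have "\<dots> = (\<integral>\<^sup>+z. ?\<phi> z * indicator {0..b} z \<partial>lborel) + (\<integral>\<^sup>+z. ?\<phi> z * indicator {-b..0} z \<partial>lborel)"
    by (rule nn_integral_add) auto
  also have "(\<integral>\<^sup>+z. ?\<phi> z * indicator {-b..0} z \<partial>lborel)
     = ennreal \<bar>-1\<bar> * (\<integral>\<^sup>+z. ?\<phi> (0 + -1 * z) * indicator {-b..0} (0 + -1 * z) \<partial>lborel)"
    by (rule nn_integral_real_affine) auto
  also have "\<dots> = (\<integral>\<^sup>+z. ?\<phi> z * indicator {0..b} z \<partial>lborel)"
    by (auto simp: std_normal_density_def indicator_def intro!: nn_integral_cong)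
  also have "(\<integral>\<^sup>+z. ?\<phi> z * indicator {0..b} z \<partial>lborel) + (\<integral>\<^sup>+z. ?\<phi> z * indicator {0..b} z \<partial>lborel)
     = (\<integral>\<^sup>+z. ?\<phi> z * indicator {0..b} z + ?\<phi> z * indicator {0..b} z \<partial>lborel)"
    by (rule nn_integral_add[symmetric]) auto
  also have "\<dots> = (\<integral>\<^sup>+z. ennreal (gamma_density (1/2) (1/2) (z\<^sup>2) * (2 * z) * indicator {0..b} z) \<partial>lborel)"
  proof (rule nn_integral_cong_AE)
    show "AE z in lborel. ?\<phi> z * indicator {0..b} z + ?\<phi> z * indicator {0..b} z
      = ennreal (gamma_density (1/2) (1/2) (z\<^sup>2) * (2 * z) * indicator {0..b} z)"
      using AE_lborel_singleton[of "0::real"]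
    proof eventually_elim
      case (elim z)
      show ?case
      proof (cases "z \<in> {0..b}")
        case True
        then have z: "z > 0" using elim by auto
        have "(z\<^sup>2) powr (- (1/2)) = inverse z"
          using z by (simp add: powr_minus powr_half_sqrt)
        moreover have "(1/2 :: real) powr (1/2) = 1 / sqrt 2"
          by (simp add: powr_half_sqrt real_sqrt_divide)
        ultimately have "gamma_density (1/2) (1/2) (z\<^sup>2) * (2 * z)
            = 1 / sqrt 2 * inverse z * exp (- z\<^sup>2 / 2) / sqrt pi * (2 * z)"
          using z by (simp add: gamma_density_def Gamma_one_half_real)
        also have "\<dots> = std_normal_density z + std_normal_density z"
          using z by (simp add: std_normal_density_def real_sqrt_mult field_simps)
        finally have "gamma_density (1/2) (1/2) (z\<^sup>2) * (2 * z) = std_normal_density z + std_normal_density z" .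
        then show ?thesis using True by (simp only: indicator_simps mult_1_right ennreal_plus normal_density_nonneg)
      qed simp
    qed
  qed
  also have "\<dots> = (\<integral>\<^sup>+x. ennreal (gamma_density (1/2) (1/2) x * indicator {0\<^sup>2..b\<^sup>2} x) \<partial>lborel)"
    by (rule nn_integral_substitution[symmetric])
       (auto intro!: derivative_eq_intros continuous_intros assms simp: set_borel_measurable_def)
  also have "\<dots> = (\<integral>\<^sup>+x. ennreal (gamma_density (1/2) (1/2) x) * indicator {..b\<^sup>2} x \<partial>lborel)"
    by (intro nn_integral_cong) (auto simp: indicator_def gamma_density_def)
  also have "\<dots> = emeasure (gamma_measure (1/2) (1/2)) {..b\<^sup>2}"
    unfolding gamma_measure_def by (rule emeasure_density[symmetric]) auto
  finally show ?thesis .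
qed

lemma chi_mix_single: "chi_mix {i} (\<lambda>_. 1) = gamma_measure (1/2) (1/2)"
proof (rule cdf_unique)
  show "real_distribution (chi_mix {i} (\<lambda>_. 1))" by (rule real_distribution_chi_mix)
  show "real_distribution (gamma_measure (1/2) (1/2))" by (rule real_distribution_gamma) auto
  have "(\<lambda>z. z i) \<in> PiM {i} (\<lambda>_. std_gauss) \<rightarrow>\<^sub>M std_gauss"
    by (rule measurable_component_singleton) simp
  then have "chi_mix {i} (\<lambda>_. 1) = distr (distr (PiM {i} (\<lambda>_. std_gauss)) std_gauss (\<lambda>z. z i)) borel (\<lambda>z. z\<^sup>2)"
    unfolding chi_mix_def by (subst distr_distr) (auto simp: comp_def)
  also have "\<dots> = distr std_gauss borel (\<lambda>z. z\<^sup>2)"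
    by (subst gauss_prod.distr_singleton) simp
  finally have chi: "chi_mix {i} (\<lambda>_. 1) = distr std_gauss borel (\<lambda>z. z\<^sup>2)" .
  show "cdf (chi_mix {i} (\<lambda>_. 1)) = cdf (gamma_measure (1/2) (1/2))"
  proof
    fix t :: real
    have e: "emeasure (chi_mix {i} (\<lambda>_. 1)) {..t} = emeasure std_gauss {z. z\<^sup>2 \<le> t}"
      unfolding chi by (subst emeasure_distr) (auto simp: vimage_def)
    have "emeasure (chi_mix {i} (\<lambda>_. 1)) {..t} = emeasure (gamma_measure (1/2) (1/2)) {..t}"
    proof (cases "0 \<le> t")
      case True
      have "z\<^sup>2 \<le> t \<longleftrightarrow> z \<in> {- sqrt t..sqrt t}" for z
        using True real_sqrt_le_iff[of "z\<^sup>2" t] by auto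
      then have "{z. z\<^sup>2 \<le> t} = {- sqrt t..sqrt t}" by blast
      then show ?thesis unfolding e using gauss_square_interval[of "sqrt t"] True by simp
    next
      case False
      then have "{z::real. z\<^sup>2 \<le> t} = {}" using zero_le_power2 order_trans by blast
      moreover have *: "ennreal (gamma_density (1/2) (1/2) x) * indicator {..t} x = 0" for x
        using False by (auto simp: gamma_density_def indicator_def)
      have "emeasure (gamma_measure (1/2) (1/2)) {..t} = 0"
        unfolding gamma_measure_def by (subst emeasure_density) (auto simp only: *, simp_all)
      ultimately show ?thesis unfolding e by simp
    qed
    then show "cdf (chi_mix {i} (\<lambda>_. 1)) t = cdf (gamma_measure (1/2) (1/2)) t"
      by (simp add: cdf_def measure_def)
  qed
qed

lemma chi_mix_one:
  assumes "finite I" "I \<noteq> {}"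
  shows "chi_mix I (\<lambda>_. 1) = gamma_measure (real (card I) / 2) (1/2)"
  using assms
proof (induction I rule: finite_ne_induct)
  case (singleton i)
  then show ?case using chi_mix_single[of i] by simp
next
  case (insert i I)
  have "chi_mix ({i} \<union> I) (\<lambda>_. 1) = (gamma_measure (1/2) (1/2) \<star> gamma_measure (real (card I) / 2) (1/2))"
    using insert by (subst chi_mix_union) (auto simp: chi_mix_single)
  also have "\<dots> = gamma_measure (1/2 + real (card I) / 2) (1/2)"
    using insert.hyps by (intro gamma_convolution) (auto simp: card_gt_0_iff)
  finally show ?case using insert.hyps by (simp add: add_divide_distrib)
qed

text \<open>Both laws are the same Gamma law scaled by \<open>c\<close>. This identifies laws whose
  equal weights sit at different indices.\<close>

lemma chi_mix_const_card:
  assumes "finite I" "I \<noteq> {}" "finite J" "card I = card J" "\<And>i. i \<in> I \<Longrightarrow> v i = c" "\<And>j. j \<in> J \<Longrightarrow> w j = c"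
  shows "chi_mix I v = chi_mix J w"
proof -
  have "J \<noteq> {}" using assms by auto
  have "chi_mix I v = chi_mix I (\<lambda>_. c)" by (rule chi_mix_cong) (rule assms)
  also have "\<dots> = chi_mix J (\<lambda>_. c)"
    using \<open>J \<noteq> {}\<close> assms(1-4) by (simp add: chi_mix_const[of _ c] chi_mix_one)
  also have "\<dots> = chi_mix J w" by (rule chi_mix_cong[symmetric]) (rule assms)
  finally show ?thesis .
qed

section \<open>Tail asymptotics\<close>

text \<open>The survival function of the chi-square law with \<open>2 * a\<close> degrees of
  freedom, for real \<open>a\<close>.\<close>

definition gamma_tail :: "real \<Rightarrow> real \<Rightarrow> real" where
  "gamma_tail a t = measure (gamma_measure a (1/2)) {t..}"

section \<open>Gamma tails as integrals of densities\<close>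

lemma integrable_gamma_density:
  assumes "a > 0" "b > 0"
  shows "integrable lborel (gamma_density a b)"
proof -
  interpret real_distribution "gamma_measure a b" by (rule real_distribution_gamma) fact+
  have "(\<integral>\<^sup>+x. ennreal (gamma_density a b x) \<partial>lborel) = 1"
    using emeasure_space_1 by (simp add: gamma_measure_def emeasure_density)
  then show ?thesis
    using assms by (intro integrableI_nonneg) (auto simp: gamma_density_nonneg)
qed

text \<open>The shift is moved into the integrand, so that shifted and unshifted tails become
  integrals over the same half-line and their quotient can be compared through the
  densities.\<close>

lemma gamma_tail_integral:
  assumes "a > 0"
  shows "gamma_tail a (t - r) = (LINT x:{t..}|lborel. gamma_density a (1/2) (x - r))"
proof -
  have "emeasure (gamma_measure a (1/2)) {t - r..}
     = (\<integral>\<^sup>+x. ennreal (gamma_density a (1/2) x) * indicator {t - r..} x \<partial>lborel)"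
    unfolding gamma_measure_def by (rule emeasure_density) auto
  also have "\<dots> = ennreal \<bar>1\<bar> *
      (\<integral>\<^sup>+x. ennreal (gamma_density a (1/2) (- r + 1 * x)) * indicator {t - r..} (- r + 1 * x) \<partial>lborel)"
    by (rule nn_integral_real_affine) auto
  also have "\<dots> = (\<integral>\<^sup>+x. ennreal (indicator {t..} x *\<^sub>R gamma_density a (1/2) (x - r)) \<partial>lborel)"
    by (auto simp: indicator_def intro!: nn_integral_cong)
  finally show ?thesis
    unfolding gamma_tail_def measure_def set_lebesgue_integral_def
    using assms by (subst integral_eq_nn_integral) (auto simp: gamma_density_nonneg)
qed

lemma gamma_tail_pos:
  assumes "a > 0"
  shows "gamma_tail a t > 0"
proof -
  interpret real_distribution "gamma_measure a (1/2)" by (rule real_distribution_gamma) (use assms in auto)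
  have "emeasure (gamma_measure a (1/2)) {t..} \<noteq> 0"
  proof
    assume "emeasure (gamma_measure a (1/2)) {t..} = 0"
    then have "AE x in lborel. ennreal (gamma_density a (1/2) x) * indicator {t..} x = 0"
      unfolding gamma_measure_def by (simp add: emeasure_density nn_integral_0_iff_AE)
    then have "AE x in lborel. x \<notin> {max t 1..max t 1 + 1}"
    proof eventually_elim
      case (elim x)
      have "gamma_density a (1/2) x > 0" if "x > 0"
        using that assms by (simp add: gamma_density_def Gamma_real_pos)
      then show ?case using elim by (auto simp: indicator_def split: if_splits)
    qed
    then have "emeasure lborel {max t 1..max t 1 + 1} = 0"
      by (subst (asm) AE_iff_null_sets[symmetric]) auto
    then show False by simp
  qed
  then show ?thesis
    unfolding gamma_tail_def using emeasure_eq_measure by (simp add: zero_less_measure_iff)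
qed

lemma gamma_tail_le_1: "a > 0 \<Longrightarrow> gamma_tail a t \<le> 1"
  unfolding gamma_tail_def
  using real_distribution_gamma[of a "1/2"] by (auto simp: real_distribution_def intro: prob_space.prob_le_1)

lemma gamma_tail_antimono:
  assumes "a > 0" "s \<le> t"
  shows "gamma_tail a t \<le> gamma_tail a s"
proof -
  interpret real_distribution "gamma_measure a (1/2)" by (rule real_distribution_gamma) (use assms in auto)
  show ?thesis unfolding gamma_tail_def using assms by (intro finite_measure_mono) auto
qed

text \<open>An integral form of L'Hopital's rule: far out, f lies between (L - e/2) g and (L + e/2)
  g, and integrating over the half-line preserves this. Using e/2 absorbs the loss of
  strictness.\<close>

lemma tail_integral_ratio_tendsto:
  fixes f g :: "real \<Rightarrow> real"
  assumes f: "integrable lborel f" and g: "integrable lborel g"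
    and pos: "\<And>t. (LINT x:{t..}|lborel. g x) > 0"
    and gpos: "eventually (\<lambda>x. g x > 0) at_top"
    and lim: "((\<lambda>x. f x / g x) \<longlongrightarrow> L) at_top"
  shows "((\<lambda>t. (LINT x:{t..}|lborel. f x) / (LINT x:{t..}|lborel. g x)) \<longlongrightarrow> L) at_top"
proof (rule tendstoI)
  fix e :: real assume "e > 0"
  then have "eventually (\<lambda>x. dist (f x / g x) L < e / 2) at_top"
    using tendstoD[OF lim, of "e / 2"] by simp
  with gpos have "eventually (\<lambda>x. (L - e / 2) * g x \<le> f x \<and> f x \<le> (L + e / 2) * g x) at_top"
  proof eventually_elim
    case (elim x)
    then have "L - e / 2 < f x / g x" "f x / g x < L + e / 2"
      unfolding dist_real_def abs_diff_less_iff by simp_all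
    then show ?case using elim by (simp add: field_simps)
  qed
  then obtain t0 where t0: "\<And>x. x \<ge> t0 \<Longrightarrow> (L - e / 2) * g x \<le> f x \<and> f x \<le> (L + e / 2) * g x"
    by (auto simp: eventually_at_top_linorder)
  have si: "set_integrable lborel {t..} h" if "integrable lborel h" for h :: "real \<Rightarrow> real" and t
    unfolding set_integrable_def using that by (intro integrable_mult_indicator) auto
  have "dist ((LINT x:{t..}|lborel. f x) / (LINT x:{t..}|lborel. g x)) L < e" if "t \<ge> t0" for t
  proof -
    let ?F = "LINT x:{t..}|lborel. f x" and ?G = "LINT x:{t..}|lborel. g x"
    have "(LINT x:{t..}|lborel. (L - e / 2) * g x) \<le> ?F" "?F \<le> (LINT x:{t..}|lborel. (L + e / 2) * g x)"
      using that t0 by (intro set_integral_mono si f g integrable_mult_right; force)+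
    then have "(L - e / 2) * ?G \<le> ?F" "?F \<le> (L + e / 2) * ?G" by simp_all
    then have "L - e / 2 \<le> ?F / ?G" "?F / ?G \<le> L + e / 2"
      using pos[of t] by (simp_all add: field_simps)
    then show ?thesis using \<open>e > 0\<close> by (simp add: dist_real_def abs_less_iff)
  qed
  then show "eventually (\<lambda>t. dist ((LINT x:{t..}|lborel. f x) / (LINT x:{t..}|lborel. g x)) L < e) at_top"
    by (auto simp: eventually_at_top_linorder)
qed

section \<open>Ratios of Gamma tails under shift and change of shape\<close>

lemma eventually_gamma_density_pos:
  assumes "a > 0" "b > 0"
  shows "eventually (\<lambda>x. gamma_density a b x > 0) at_top"
  using eventually_gt_at_top[of 0]
  by eventually_elim (use assms in \<open>simp add: gamma_density_def Gamma_real_pos\<close>)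

text \<open>The quotient of the densities is (1 - r/x)^(a-1) exp(r/2): the power tends to 1 and only
  the exponential factor survives.\<close>

lemma gamma_tail_shift:
  assumes "a > 0"
  shows "((\<lambda>t. gamma_tail a (t - r) / gamma_tail a t) \<longlongrightarrow> exp (r / 2)) at_top"
proof -
  let ?g = "gamma_density a (1/2)"
  have "((\<lambda>x. (1 - r / x) powr (a - 1) * exp (r / 2)) \<longlongrightarrow> (1 - 0) powr (a - 1) * exp (r / 2)) at_top"
    by (intro tendsto_intros tendsto_divide_0[OF tendsto_const] filterlim_at_top_imp_at_infinity filterlim_ident) auto
  moreover have "eventually (\<lambda>x. (1 - r / x) powr (a - 1) * exp (r / 2) = ?g (x - r) / ?g x) at_top"
    using eventually_gt_at_top[of "max 0 r"]
  proof eventually_elim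
    case (elim x)
    have "x * (1 - r / x) = x - r" using elim by (simp add: right_diff_distrib)
    then have "(x - r) powr (a - 1) = (x * (1 - r / x)) powr (a - 1)" by simp
    also have "\<dots> = x powr (a - 1) * (1 - r / x) powr (a - 1)"
      by (rule powr_mult)
    finally have 1: "(x - r) powr (a - 1) = x powr (a - 1) * (1 - r / x) powr (a - 1)" .
    have 2: "exp (- (1/2) * (x - r)) = exp (- (1/2) * x) * exp (r / 2)"
      unfolding exp_add[symmetric] by (simp add: field_simps)
    have "Gamma a \<noteq> 0" using Gamma_real_pos[OF assms] by simp
    then show ?case using elim unfolding gamma_density_def 1 2 by simp
  qed
  ultimately have lim: "((\<lambda>x. ?g (x - r) / ?g x) \<longlongrightarrow> exp (r / 2)) at_top"
    using tendsto_cong by fastforce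
  have int: "integrable lborel ?g" by (rule integrable_gamma_density) (use assms in auto)
  have "integrable lborel (\<lambda>x. ?g (x - r))"
    using lborel_integrable_real_affine[OF int, of 1 "- r"] by simp
  from tail_integral_ratio_tendsto[OF this int _ _ lim]
  have "((\<lambda>t. (LINT x:{t..}|lborel. ?g (x - r)) / (LINT x:{t..}|lborel. ?g x)) \<longlongrightarrow> exp (r / 2)) at_top"
    using gamma_tail_pos[OF assms] gamma_tail_integral[OF assms, of _ 0]
      eventually_gamma_density_pos[OF assms, of "1/2"] by simp
  then show ?thesis
    using gamma_tail_integral[OF assms, of _ r] gamma_tail_integral[OF assms, of _ 0] by simp
qed

text \<open>At equal rates the exponentials cancel, and the quotient of the densities is a constant
  times x^(a-b), with negative exponent.\<close>

lemma gamma_tail_shape: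
  assumes "0 < a" "a < b"
  shows "((\<lambda>t. gamma_tail a t / gamma_tail b t) \<longlongrightarrow> 0) at_top"
proof -
  have b: "b > 0" using assms by simp
  let ?g = "\<lambda>a. gamma_density a (1/2)"
  define C where "C = (1/2) powr (a - b) * Gamma b / Gamma a"
  have "((\<lambda>x. C * x powr (a - b)) \<longlongrightarrow> C * 0) at_top"
    using assms by (intro tendsto_intros tendsto_neg_powr filterlim_ident) auto
  moreover have "eventually (\<lambda>x. C * x powr (a - b) = ?g a x / ?g b x) at_top"
    using eventually_gt_at_top[of 0]
  proof eventually_elim
    case (elim x)
    have G: "Gamma a > 0" "Gamma b > 0" using assms b by (auto intro: Gamma_real_pos)
    have "x powr (a - 1) = x powr (a - b) * x powr (b - 1)"
      "(1/2 :: real) powr a = (1/2) powr (a - b) * (1/2) powr b"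
      by (simp_all add: powr_add[symmetric])
    then show ?case using elim G by (simp add: C_def gamma_density_def)
  qed
  ultimately have lim: "((\<lambda>x. ?g a x / ?g b x) \<longlongrightarrow> 0) at_top"
    using tendsto_cong by fastforce
  have "integrable lborel (?g a)" "integrable lborel (?g b)"
    using integrable_gamma_density assms b by auto
  from tail_integral_ratio_tendsto[OF this _ _ lim]
  have "((\<lambda>t. (LINT x:{t..}|lborel. ?g a x) / (LINT x:{t..}|lborel. ?g b x)) \<longlongrightarrow> 0) at_top"
    using gamma_tail_pos[OF b] gamma_tail_integral[OF b, of _ 0]
      eventually_gamma_density_pos[OF b, of "1/2"] by simp
  then show ?thesis
    using gamma_tail_integral[OF b, of _ 0] gamma_tail_integral[OF assms(1), of _ 0] by simp
qed

text \<open>The bound follows by iterating the one-step estimate T(t - 1) <= exp(s) T(t), valid for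
  large t because the limit ratio is exp(1/2).\<close>
lemma gamma_tail_shift_bound:
  assumes "a > 0" "s > 1/2"
  obtains t0 where "\<And>t r. t \<ge> t0 \<Longrightarrow> r \<ge> 0 \<Longrightarrow>
    gamma_tail a (t - r) / gamma_tail a t \<le> exp (s * (r + 1)) / gamma_tail a t0"
proof -
  let ?T = "gamma_tail a"
  note pos = gamma_tail_pos[OF assms(1)] and anti = gamma_tail_antimono[OF assms(1)]
    and le1 = gamma_tail_le_1[OF assms(1)]
  have "eventually (\<lambda>t. ?T (t - 1) / ?T t < exp s) at_top"
    using gamma_tail_shift[OF assms(1), of 1] assms(2) by (intro order_tendstoD) auto
  then obtain t0 where t0: "\<And>t. t \<ge> t0 \<Longrightarrow> ?T (t - 1) / ?T t < exp s"
    by (auto simp: eventually_at_top_linorder)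
  have one: "?T (t - 1) \<le> exp s * ?T t" if "t \<ge> t0" for t
    using t0[OF that] pos[of t] by (simp add: field_simps)
  have iter: "?T (t - real j) \<le> exp (s * real j) * ?T t" if "t - real j \<ge> t0 - 1" for t j
    using that
  proof (induction j)
    case (Suc j)
    have "?T (t - real (Suc j)) = ?T ((t - real j) - 1)" by (simp add: algebra_simps)
    also have "\<dots> \<le> exp s * ?T (t - real j)" using Suc.prems by (intro one) simp
    also have "\<dots> \<le> exp s * (exp (s * real j) * ?T t)"
      using Suc by (intro mult_left_mono Suc.IH) auto
    also have "\<dots> = exp (s * real (Suc j)) * ?T t" by (simp add: exp_add[symmetric] algebra_simps mult_exp_exp)
    finally show ?case .
  qed simp
  show thesis
  proof (rule that)
    fix t r :: real assume t: "t \<ge> t0" and r: "r \<ge> 0"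
    \<comment> \<open>Rounding \<open>r\<close> up to whole steps costs less than one step, hence
      \<open>r + 1\<close> in the bound.\<close>
    define j where "j = nat \<lceil>r\<rceil>"
    have j: "r \<le> real j" "real j < r + 1" using r unfolding j_def by linarith+
    have "?T (t - r) * ?T t0 \<le> exp (s * (r + 1)) * ?T t"
    proof (cases "t - real j \<ge> t0 - 1")
      case True
      have "?T (t - r) * ?T t0 \<le> ?T (t - r) * 1"
        using pos le1 by (intro mult_left_mono) (auto intro: less_imp_le)
      also have "\<dots> \<le> ?T (t - real j)" using j by (simp add: anti)
      also have "\<dots> \<le> exp (s * real j) * ?T t" by (rule iter[OF True])
      also have "\<dots> \<le> exp (s * (r + 1)) * ?T t"
        using j assms(2) pos[of t] by (intro mult_right_mono) auto
      finally show ?thesis .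
    next
      case False
      define i where "i = nat \<lfloor>t - t0 + 1\<rfloor>"
      have i: "real i \<le> t - t0 + 1" "t - t0 < real i" using t unfolding i_def by linarith+
      have "?T (t - r) * ?T t0 \<le> 1 * ?T t0"
        using pos le1 by (intro mult_right_mono) (auto intro: less_imp_le)
      also have "\<dots> \<le> ?T (t - real i)" using i by (simp add: anti)
      also have "\<dots> \<le> exp (s * real i) * ?T t" using i by (intro iter) simp
      also have "\<dots> \<le> exp (s * (r + 1)) * ?T t"
        using i j False assms(2) pos[of t] by (intro mult_right_mono) auto
      finally show ?thesis .
    qed
    then show "?T (t - r) / ?T t \<le> exp (s * (r + 1)) / ?T t0"
      using pos[of t] pos[of t0] by (simp add: field_simps)
  qed
qed

text \<open>Conditioning on the second summand x makes the quotient the mean of T(t - x) / T(t),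
  where T is the Gamma tail; the integrand tends to exp(x/2). The shift bound dominates it by a
  multiple of exp(s x), which is where nonnegativity and a moment beyond 1/2 enter.\<close>

lemma gamma_convolution_tail:
  assumes "a > 0" and rho: "real_distribution \<rho>" and nonneg: "AE x in \<rho>. 0 \<le> x"
    and s: "s > 1/2" "integrable \<rho> (\<lambda>x. exp (s * x))"
  shows "((\<lambda>t. measure (gamma_measure a (1/2) \<star> \<rho>) {t..} / gamma_tail a t) \<longlongrightarrow> (\<integral>x. exp (x / 2) \<partial>\<rho>)) at_top"
proof -
  interpret \<rho>: real_distribution \<rho> by fact
  interpret G: real_distribution "gamma_measure a (1/2)" by (rule real_distribution_gamma) (use assms in auto)
  let ?T = "gamma_tail a"
  note pos = gamma_tail_pos[OF assms(1)]
  have meas: "(\<lambda>x. ?T (t - x)) \<in> borel_measurable borel" for t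
    by (rule borel_measurable_mono) (auto simp: mono_def intro: gamma_tail_antimono[OF assms(1)])
  have conv: "measure (gamma_measure a (1/2) \<star> \<rho>) {t..} = (\<integral>x. ?T (t - x) \<partial>\<rho>)" for t
  proof -
    have "emeasure (gamma_measure a (1/2) \<star> \<rho>) {t..} = emeasure (\<rho> \<star> gamma_measure a (1/2)) {t..}"
      by (subst convolution_commutative) (auto simp: \<rho>.finite_measure_axioms G.finite_measure_axioms)
    also have "\<dots> = (\<integral>\<^sup>+x. emeasure (gamma_measure a (1/2)) {y. y + x \<in> {t..}} \<partial>\<rho>)"
      by (rule convolution_emeasure) (auto simp: \<rho>.finite_measure_axioms G.finite_measure_axioms)
    also have "\<dots> = (\<integral>\<^sup>+x. ennreal (?T (t - x)) \<partial>\<rho>)"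
    proof (rule nn_integral_cong)
      fix x
      have "{y. y + x \<in> {t..}} = {t - x..}" by auto
      then show "emeasure (gamma_measure a (1/2)) {y. y + x \<in> {t..}} = ennreal (?T (t - x))"
        by (simp add: gamma_tail_def G.emeasure_eq_measure)
    qed
    finally show ?thesis
      unfolding measure_def using meas pos
      by (subst integral_eq_nn_integral) (auto intro: less_imp_le)
  qed
  obtain t0 where t0: "\<And>t r. t \<ge> t0 \<Longrightarrow> r \<ge> 0 \<Longrightarrow> ?T (t - r) / ?T t \<le> exp (s * (r + 1)) / ?T t0"
    using gamma_tail_shift_bound[OF assms(1) s(1)] by blast
  have "((\<lambda>t. \<integral>x. ?T (t - x) / ?T t \<partial>\<rho>) \<longlongrightarrow> (\<integral>x. exp (x / 2) \<partial>\<rho>)) at_top"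
  proof (rule integral_dominated_convergence_at_top)
    show "(\<lambda>x. exp (x / 2)) \<in> borel_measurable \<rho>" by simp
    show "(\<lambda>x. ?T (t - x) / ?T t) \<in> borel_measurable \<rho>" for t
      using meas by simp
    show "integrable \<rho> (\<lambda>x. exp s / ?T t0 * exp (s * x))"
      using s(2) by (rule integrable_mult_right)
    show "AE x in \<rho>. ((\<lambda>t. ?T (t - x) / ?T t) \<longlongrightarrow> exp (x / 2)) at_top"
      using gamma_tail_shift[OF assms(1)] by simp
    show "\<forall>\<^sub>F t in at_top. AE x in \<rho>. norm (?T (t - x) / ?T t) \<le> exp s / ?T t0 * exp (s * x)"
      using eventually_ge_at_top[of t0]
    proof eventually_elim
      case (elim t)
      show ?case using nonneg
      proof eventually_elim
        case (elim x)
        have "norm (?T (t - x) / ?T t) = ?T (t - x) / ?T t"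
          using pos[of t] pos[of "t - x"] by simp
        also have "\<dots> \<le> exp (s * (x + 1)) / ?T t0" using t0 elim \<open>t0 \<le> t\<close> by blast
        also have "\<dots> = exp s / ?T t0 * exp (s * x)" by (simp add: exp_add distrib_left)
        finally show ?case .
      qed
    qed
  qed
  then show ?thesis unfolding conv by simp
qed

text \<open>Both functions are measured against the tail of shape \<open>b\<close>. For
  \<open>a < b\<close> the first quotient then tends to 0 whatever \<open>C\<close> is, and
  \<open>0 < D\<close> beats it; any number strictly between the two limits separates the
  quotients.\<close>

lemma eventually_le_of_tail_limits:
  assumes F: "((\<lambda>t. F t / gamma_tail a t) \<longlongrightarrow> C) at_top"
    and G: "((\<lambda>t. G t / gamma_tail b t) \<longlongrightarrow> D) at_top"
    and "0 < a" "0 < D" "a < b \<or> a = b \<and> C < D"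
  shows "eventually (\<lambda>t. F t \<le> G t) at_top"
proof -
  have b: "b > 0" using assms by auto
  obtain C' where C': "((\<lambda>t. F t / gamma_tail b t) \<longlongrightarrow> C') at_top" "C' < D"
  proof (cases "a < b")
    case True
    have "((\<lambda>t. F t / gamma_tail a t * (gamma_tail a t / gamma_tail b t)) \<longlongrightarrow> C * 0) at_top"
      by (intro tendsto_mult F gamma_tail_shape \<open>0 < a\<close> True)
    moreover have "F t / gamma_tail a t * (gamma_tail a t / gamma_tail b t) = F t / gamma_tail b t" for t
      using gamma_tail_pos[OF \<open>0 < a\<close>, of t] by simp
    ultimately have "((\<lambda>t. F t / gamma_tail b t) \<longlongrightarrow> 0) at_top" by (simp only: mult_zero_right)
    then show ?thesis using that \<open>0 < D\<close> by blast
  next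
    case False
    then show ?thesis using that[of C] F assms by simp
  qed
  then obtain e where e: "C' < e" "e < D" using dense by blast
  have "eventually (\<lambda>t. F t / gamma_tail b t < e) at_top" by (rule order_tendstoD(2)[OF C'(1) e(1)])
  moreover have "eventually (\<lambda>t. e < G t / gamma_tail b t) at_top" by (rule order_tendstoD(1)[OF G e(2)])
  ultimately show ?thesis
  proof eventually_elim
    case (elim t)
    then have "F t / gamma_tail b t < G t / gamma_tail b t" by simp
    then show ?case using gamma_tail_pos[OF b, of t] by (simp add: divide_less_cancel)
  qed
qed

section \<open>Comparison of the three tails\<close>

lemma chi_mix_tail:
  assumes J: "finite J" and w: "\<And>p. p \<in> J \<Longrightarrow> 0 \<le> w p \<and> w p \<le> 1"
    and K: "K = {p\<in>J. w p = 1}" "K \<noteq> {}"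
  shows "((\<lambda>t. measure (chi_mix J w) {t..} / gamma_tail (real (card K) / 2) t)
     \<longlongrightarrow> (\<Prod>p\<in>J-K. (1 - w p) powr (- 1 / 2))) at_top"
proof -
  have fin: "finite K" "finite (J - K)" using J K by auto
  have "chi_mix J w = chi_mix (K \<union> (J - K)) w" using K by (intro arg_cong2[where f = chi_mix]) auto
  also have "\<dots> = (chi_mix K w \<star> chi_mix (J - K) w)" by (rule chi_mix_union) (use fin in auto)
  also have "chi_mix K w = chi_mix K (\<lambda>_. 1)" by (rule chi_mix_cong) (use K in auto)
  also have "\<dots> = gamma_measure (real (card K) / 2) (1/2)" by (rule chi_mix_one) (use fin K in auto)
  finally have conv: "chi_mix J w = (gamma_measure (real (card K) / 2) (1/2) \<star> chi_mix (J - K) w)" .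
  \<comment> \<open>The inserted 0 covers the case that all weights are top weights.\<close>
  define W where "W = Max (insert 0 (w ` (J - K)))"
  have wW: "w p \<le> W" if "p \<in> J - K" for p
    unfolding W_def using fin that by (auto intro!: Max_ge)
  have "0 \<le> W" unfolding W_def using fin by (intro Max_ge) auto
  moreover have "W < 1"
    unfolding W_def using fin w K by (subst Max_less_iff) (auto simp: less_le)
  ultimately have W01: "0 \<le> W" "W < 1" by auto
  \<comment> \<open>W < 1 gives s > 1/2, and 2 s W = 2 W / (1 + W) < 1 keeps the exponential moment
    at s finite.\<close>
  define s where "s = 1 / (1 + W)"
  have s: "s > 1/2" using W01 by (simp add: s_def field_simps)
  have sw: "2 * s * w p < 1" if "p \<in> J - K" for p
    using wW[OF that] W01 by (simp add: s_def field_simps)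
  have "card K > 0" using fin K by (simp add: card_gt_0_iff)
  have "((\<lambda>t. measure (chi_mix J w) {t..} / gamma_tail (real (card K) / 2) t)
      \<longlongrightarrow> (\<integral>x. exp (x / 2) \<partial>chi_mix (J - K) w)) at_top"
    unfolding conv
    by (rule gamma_convolution_tail[where s = s])
       (use s sw fin w \<open>card K > 0\<close> in \<open>auto intro!: real_distribution_chi_mix chi_mix_nonneg exp_integral_chi_mix\<close>)
  also have "(\<integral>x. exp (x / 2) \<partial>chi_mix (J - K) w) = (\<Prod>p\<in>J-K. (1 - w p) powr (- 1 / 2))"
  proof -
    have "w p < 1" if "p \<in> J - K" for p using that w[of p] K by (auto simp: less_le)
    then show ?thesis using exp_integral_chi_mix(2)[of "J - K" "1/2" w] fin by simp
  qed
  finally show ?thesis .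
qed

text \<open>Each weight occurs once per sample: the shape is multiplied by \<open>m\<close> and the
  constant of one row is raised to the power \<open>m\<close>.\<close>

lemma chi_mix_rows_tail:
  fixes m :: nat
  assumes I: "finite I" and x: "\<And>i. i \<in> I \<Longrightarrow> 0 \<le> x i \<and> x i \<le> 1"
    and K: "K = {i\<in>I. x i = 1}" "K \<noteq> {}" and m: "m \<ge> 1"
  shows "((\<lambda>t. measure (chi_mix ({..<m} \<times> I) (\<lambda>p. x (snd p))) {t..} / gamma_tail (real m * real (card K) / 2) t)
     \<longlongrightarrow> ((\<Prod>i\<in>I-K. 1 - x i) powr (- 1 / 2)) ^ m) at_top"
proof -
  have KK: "{..<m} \<times> K = {p\<in>{..<m} \<times> I. x (snd p) = 1}" "{..<m} \<times> K \<noteq> {}"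
    using K m by (auto simp: lessThan_empty_iff)
  have "(\<Prod>p\<in>{..<m} \<times> I - {..<m} \<times> K. (1 - x (snd p)) powr (- 1 / 2))
     = (\<Prod>(j, i)\<in>{..<m} \<times> (I - K). (1 - x i) powr (- 1 / 2))"
    by (rule prod.cong) auto
  also have "\<dots> = (\<Prod>j<m. \<Prod>i\<in>I-K. (1 - x i) powr (- 1 / 2))"
    by (rule prod.cartesian_product[symmetric])
  also have "(\<Prod>i\<in>I-K. (1 - x i) powr (- 1 / 2)) = (\<Prod>i\<in>I-K. 1 - x i) powr (- 1 / 2)"
    by (rule prod_powr_distrib[symmetric])
  finally have "(\<Prod>p\<in>{..<m} \<times> I - {..<m} \<times> K. (1 - x (snd p)) powr (- 1 / 2))
      = ((\<Prod>i\<in>I-K. 1 - x i) powr (- 1 / 2)) ^ m" by simp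
  then show ?thesis
    using chi_mix_tail[OF _ _ KK] I x by (auto simp: card_cartesian_product)
qed

text \<open>The Weierstrass product inequality.\<close>

lemma one_minus_sum_le_prod:
  fixes x :: "'a \<Rightarrow> real"
  assumes "finite R" "\<And>i. i \<in> R \<Longrightarrow> 0 \<le> x i \<and> x i \<le> 1"
  shows "1 - sum x R \<le> (\<Prod>i\<in>R. 1 - x i)"
  using assms
proof (induction R rule: finite_induct)
  case (insert i R)
  have "0 \<le> x i * sum x R" using insert.prems by (intro mult_nonneg_nonneg sum_nonneg) auto
  then have "1 - sum x (insert i R) \<le> (1 - x i) * (1 - sum x R)"
    using insert.hyps by (simp add: algebra_simps)
  also have "\<dots> \<le> (1 - x i) * (\<Prod>i\<in>R. 1 - x i)"
    using insert by (intro mult_left_mono) auto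
  finally show ?case using insert.hyps by simp
qed simp

text \<open>Splitting off \<open>i\<close> leaves a cross term, \<open>x i\<close> times the sum of
  the other weights, which the weak inequality throws away. It is positive because \<open>j\<close>
  is among the others.\<close>

lemma one_minus_sum_less_prod:
  fixes x :: "'a \<Rightarrow> real"
  assumes R: "finite R" "\<And>i. i \<in> R \<Longrightarrow> 0 \<le> x i \<and> x i < 1"
    and ij: "i \<in> R" "j \<in> R" "i \<noteq> j" "0 < x i" "0 < x j"
  shows "1 - sum x R < (\<Prod>i\<in>R. 1 - x i)"
proof -
  have "x j \<le> sum x (R - {i})" using R ij by (intro member_le_sum) auto
  then have "0 < x i * sum x (R - {i})" using ij by simp
  then have "1 - (x i + sum x (R - {i})) < (1 - x i) * (1 - sum x (R - {i}))"
    by (simp add: algebra_simps)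
  also have "\<dots> \<le> (1 - x i) * (\<Prod>i\<in>R-{i}. 1 - x i)"
    using R ij by (intro mult_left_mono one_minus_sum_le_prod) (auto simp: less_imp_le)
  finally show ?thesis using R ij by (simp add: sum.remove[of R i x] prod.remove[of R i])
qed

text \<open>The diagonal of \<mu> times A_rel, scaled so that the top weight is 1. For integer \<mu>
  the last relevant weight is 0.\<close>

definition rel_weight :: "real \<Rightarrow> nat \<Rightarrow> real" where
  "rel_weight \<mu> i = (if i < nat \<lfloor>\<mu>\<rfloor> then 1 else if i = nat \<lfloor>\<mu>\<rfloor> then \<mu> - of_int \<lfloor>\<mu>\<rfloor> else 0)"

text \<open>\<open>Y\<close> is the law of m * \<mu> times the estimator for A_rel, and
  \<open>d\<close> and \<open>f\<close> are the integer and fractional parts of \<mu>.\<close>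

context
  fixes \<mu> :: real and m d :: nat and f :: real and Y
  assumes \<mu>: "\<mu> \<ge> 1" and m: "m \<ge> 1"
  defines "d \<equiv> nat \<lfloor>\<mu>\<rfloor>" and "f \<equiv> \<mu> - of_int \<lfloor>\<mu>\<rfloor>"
    and "Y \<equiv> chi_mix ({..<m} \<times> {..<Suc (nat \<lfloor>\<mu>\<rfloor>)}) (\<lambda>p. rel_weight \<mu> (snd p))"
begin

lemma floor_frac: "d \<ge> 1" "0 \<le> f" "f < 1" "\<mu> = real d + f"
  using \<mu> unfolding d_def f_def by linarith+

lemma rel_weight_eq: "rel_weight \<mu> i = (if i < d then 1 else if i = d then f else 0)"
  by (simp add: rel_weight_def d_def f_def)

lemma rel_tail:
  "((\<lambda>t. measure Y {t..} / gamma_tail (real m * real d / 2) t) \<longlongrightarrow> ((1 - f) powr (- 1 / 2)) ^ m) at_top"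
proof -
  \<comment> \<open>\<open>f < 1\<close> keeps the index \<open>d\<close> out of the top
    weights.\<close>
  have K: "{..<d} = {i\<in>{..<Suc d}. rel_weight \<mu> i = 1}" "{..<d} \<noteq> {}"
    using floor_frac(1-3) by (auto simp: rel_weight_eq lessThan_empty_iff split: if_splits)
  have "{..<Suc d} - {..<d} = {d}" by auto
  then have "(\<Prod>i\<in>{..<Suc d} - {..<d}. 1 - rel_weight \<mu> i) = 1 - f"
    by (simp add: rel_weight_eq)
  then show ?thesis
    using chi_mix_rows_tail[OF _ _ K m] floor_frac(1-3) unfolding Y_def d_def[symmetric]
    by (simp add: rel_weight_eq)
qed

lemma rel_split:
  "Y = (gamma_measure (real m * real d / 2) (1/2) \<star> chi_mix ({..<m} \<times> {d}) (\<lambda>_. f))"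
proof -
  have "Y = chi_mix ({..<m} \<times> {..<d} \<union> {..<m} \<times> {d}) (\<lambda>p. rel_weight \<mu> (snd p))"
    unfolding Y_def d_def[symmetric] by (intro arg_cong2[where f = chi_mix]) auto
  also have "\<dots> = (chi_mix ({..<m} \<times> {..<d}) (\<lambda>p. rel_weight \<mu> (snd p))
      \<star> chi_mix ({..<m} \<times> {d}) (\<lambda>p. rel_weight \<mu> (snd p)))"
    by (rule chi_mix_union) auto
  also have "chi_mix ({..<m} \<times> {d}) (\<lambda>p. rel_weight \<mu> (snd p)) = chi_mix ({..<m} \<times> {d}) (\<lambda>_. f)"
    by (rule chi_mix_cong) (auto simp: rel_weight_eq)
  also have "chi_mix ({..<m} \<times> {..<d}) (\<lambda>p. rel_weight \<mu> (snd p)) = chi_mix ({..<m} \<times> {..<d}) (\<lambda>_. 1)"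
    by (rule chi_mix_cong) (auto simp: rel_weight_eq)
  also have "\<dots> = gamma_measure (real m * real d / 2) (1/2)"
    using m floor_frac by (subst chi_mix_one) (auto simp: card_cartesian_product lessThan_empty_iff)
  finally show ?thesis .
qed

text \<open>For \<open>f = 0\<close> the factor with weight \<open>f\<close> is a point mass at 0
  and the two laws coincide; for \<open>f > 0\<close> the Gamma law has the strictly larger
  shape.\<close>

lemma rel_le_gamma:
  "eventually (\<lambda>t. measure Y {t..} \<le> gamma_tail (real m * \<mu> / 2) t) at_top"
proof (cases "f = 0")
  case True
  have "Y = gamma_measure (real m * real d / 2) (1/2)"
    unfolding rel_split using True m floor_frac(1)
    by (subst chi_mix_zero) (auto intro!: convolution_return_zero real_distribution_gamma)
  then show ?thesis using floor_frac True by (simp add: gamma_tail_def)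
next
  case False
  have lim: "((\<lambda>t. gamma_tail (real m * \<mu> / 2) t / gamma_tail (real m * \<mu> / 2) t) \<longlongrightarrow> 1) at_top"
  proof -
    have "gamma_tail (real m * \<mu> / 2) t \<noteq> 0" for t
      using gamma_tail_pos[of "real m * \<mu> / 2" t] m \<mu> by simp
    then show ?thesis by simp
  qed
  have "real m * real d / 2 < real m * \<mu> / 2" using False m floor_frac by simp
  then show ?thesis
    using m floor_frac(1) by (intro eventually_le_of_tail_limits[OF rel_tail lim]) auto
qed

lemma mix_le_rel:
  assumes I: "finite I" and x: "\<And>i. i \<in> I \<Longrightarrow> 0 \<le> x i \<and> x i \<le> 1"
    and top: "\<exists>i\<in>I. x i = 1" and sum: "sum x I = \<mu>"
  shows "eventually (\<lambda>t. measure (chi_mix ({..<m} \<times> I) (\<lambda>p. x (snd p))) {t..} \<le> measure Y {t..}) at_top"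
proof -
  define K where "K = {i\<in>I. x i = 1}"
  define R where "R = I - K"
  have fin: "finite K" "finite R" using I by (auto simp: K_def R_def)
  have Kne: "K \<noteq> {}" using top by (auto simp: K_def)
  have cK: "card K > 0" using Kne fin by (simp add: card_gt_0_iff)
  have xR: "0 \<le> x i" "x i < 1" if "i \<in> R" for i
    using that x[of i] by (auto simp: R_def K_def less_le)
  have "sum x I = sum x R + sum x K"
    unfolding R_def by (rule sum.subset_diff) (use I in \<open>auto simp: K_def\<close>)
  also have "sum x K = real (card K)" by (simp add: K_def)
  finally have sumR: "sum x R = \<mu> - real (card K)" using sum by simp
  have "0 \<le> sum x R" by (rule sum_nonneg) (use xR in auto)
  \<comment> \<open>The remaining weights have nonnegative sum \<mu> - card K, and
    \<open>card K\<close> is an integer.\<close>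
  then have kd: "card K \<le> d" using sumR unfolding d_def by linarith
  note tail = chi_mix_rows_tail[OF I x K_def Kne m]
  consider "card K < d" | i j where "card K = d" "i \<in> R" "j \<in> R" "i \<noteq> j" "0 < x i" "0 < x j"
    | "card K = d" "\<forall>i\<in>R. \<forall>j\<in>R. i \<noteq> j \<longrightarrow> x i = 0 \<or> x j = 0"
  proof -
    have "card K < d \<or> card K = d" using kd by linarith
    moreover have "(\<exists>i\<in>R. \<exists>j\<in>R. i \<noteq> j \<and> 0 < x i \<and> 0 < x j)
        \<or> (\<forall>i\<in>R. \<forall>j\<in>R. i \<noteq> j \<longrightarrow> x i = 0 \<or> x j = 0)"
      using xR(1) by (metis less_eq_real_def)
    ultimately show thesis using that by blast
  qed
  then show ?thesis
  proof cases
    case 1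
    then show ?thesis
      using m cK floor_frac(1-3) by (intro eventually_le_of_tail_limits[OF tail rel_tail]) auto
  next
    case 2
    \<comment> \<open>The remaining mass is exactly \<open>f\<close>: A_rel puts it into one weight,
      \<open>x\<close> spreads it over at least two. Spreading enlarges the product, and the
      negative exponent turns this into a smaller constant.\<close>
    have f: "f = sum x R" using sumR 2 floor_frac by simp
    have "1 - f < (\<Prod>i\<in>R. 1 - x i)"
      unfolding f by (rule one_minus_sum_less_prod[of R x i j]) (use fin xR 2 in auto)
    then have "(\<Prod>i\<in>R. 1 - x i) powr (- 1 / 2) < (1 - f) powr (- 1 / 2)"
      using floor_frac by (intro powr_less_mono2_neg) auto
    then have "((\<Prod>i\<in>R. 1 - x i) powr (- 1 / 2)) ^ m < ((1 - f) powr (- 1 / 2)) ^ m"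
      using m by (intro power_strict_mono) auto
    then show ?thesis
      using 2 m cK floor_frac(1-3) by (intro eventually_le_of_tail_limits[OF tail rel_tail]) (auto simp: R_def)
  next
    case 3
    have f: "f = sum x R" using sumR 3 floor_frac by simp
    \<comment> \<open>At most one remaining weight is nonzero, and then it equals \<open>f\<close>.
      Its index is unrelated to \<open>d\<close>, so the laws are identified rather than the
      families of weights.\<close>
    have rest: "chi_mix ({..<m} \<times> R) (\<lambda>p. x (snd p)) = chi_mix ({..<m} \<times> {d}) (\<lambda>_. f)"
    proof (cases "f = 0")
      case True
      then have "x i = 0" if "i \<in> R" for i
        using that f sum_nonneg_eq_0_iff[of R x] fin xR by auto
      then show ?thesis using True by (subst (1 2) chi_mix_zero) auto
    next
      case False
      then have "sum x R \<noteq> 0" using f by simp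
      then obtain i where i: "i \<in> R" "x i \<noteq> 0" by (rule sum.not_neutral_contains_not_neutral)
      then have z: "x j = 0" if "j \<in> R - {i}" for j using 3 that by auto
      have fi: "x i = f" using f sum.remove[OF fin(2) i(1), of x] z by simp
      have "chi_mix ({..<m} \<times> R) (\<lambda>p. x (snd p))
          = chi_mix ({..<m} \<times> {i} \<union> {..<m} \<times> (R - {i})) (\<lambda>p. x (snd p))"
        using i by (intro arg_cong2[where f = chi_mix]) auto
      also have "\<dots> = (chi_mix ({..<m} \<times> {i}) (\<lambda>p. x (snd p)) \<star> chi_mix ({..<m} \<times> (R - {i})) (\<lambda>p. x (snd p)))"
        by (rule chi_mix_union) (use fin in auto)
      also have "chi_mix ({..<m} \<times> (R - {i})) (\<lambda>p. x (snd p)) = return borel 0"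
        by (rule chi_mix_zero, rule z) auto
      also have "(chi_mix ({..<m} \<times> {i}) (\<lambda>p. x (snd p)) \<star> return borel 0) = chi_mix ({..<m} \<times> {i}) (\<lambda>p. x (snd p))"
        by (rule convolution_return_zero[OF real_distribution_chi_mix])
      also have "\<dots> = chi_mix ({..<m} \<times> {d}) (\<lambda>_. f)"
        by (rule chi_mix_const_card[where c = f]) (use m fi in \<open>auto simp: card_cartesian_product lessThan_empty_iff\<close>)
      finally show ?thesis .
    qed
    have "chi_mix ({..<m} \<times> I) (\<lambda>p. x (snd p)) = chi_mix ({..<m} \<times> K \<union> {..<m} \<times> R) (\<lambda>p. x (snd p))"
      by (intro arg_cong2[where f = chi_mix]) (auto simp: K_def R_def)
    also have "\<dots> = (chi_mix ({..<m} \<times> K) (\<lambda>p. x (snd p)) \<star> chi_mix ({..<m} \<times> R) (\<lambda>p. x (snd p)))"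
      by (rule chi_mix_union) (use fin in \<open>auto simp: R_def\<close>)
    also have "chi_mix ({..<m} \<times> K) (\<lambda>p. x (snd p)) = chi_mix ({..<m} \<times> K) (\<lambda>_. 1)"
      by (rule chi_mix_cong) (auto simp: K_def)
    also have "\<dots> = gamma_measure (real m * real d / 2) (1/2)"
      using m fin Kne 3 by (subst chi_mix_one) (auto simp: card_cartesian_product lessThan_empty_iff)
    finally have "chi_mix ({..<m} \<times> I) (\<lambda>p. x (snd p)) = Y" unfolding rel_split rest .
    then show ?thesis by simp
  qed
qed

end

section \<open>Reduction of the deviation events to tails\<close>

lemma measure_quad_form_ge:
  assumes T: "T \<in> rotations {..<N}" and l: "\<And>x. quad_form N B (T x) = (\<Sum>i<N. l i * (x i)\<^sup>2)"
  shows "measure (gauss_samples m N) {z \<in> space (gauss_samples m N). c \<le> (\<Sum>j<m. quad_form N B (\<lambda>i. z (j, i)))}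
    = measure (chi_mix ({..<m} \<times> {..<N}) (\<lambda>p. l (snd p))) {c..}"
proof -
  let ?J = "{..<m} \<times> {..<N}"
  let ?P = "PiM ?J (\<lambda>_. std_gauss)"
  let ?S = "\<lambda>z. \<Sum>j<m. quad_form N B (\<lambda>i. z (j, i))"
  \<comment> \<open>\<open>U\<close> applies \<open>T\<close> to every sample; it preserves the
    product measure and diagonalises the form in each row.\<close>
  define U where "U z p = (if fst p \<in> {..<m} then T (\<lambda>i. z (fst p, i)) (snd p) else z p)"
    for z :: "nat \<times> nat \<Rightarrow> real" and p
  have "U \<in> rotations ?J"
    using rotations_rows[OF T, of "{..<m}"] unfolding U_def[abs_def] by simp
  note U = rotation_invariance[OF this]
  have S: "?S \<in> borel_measurable ?P"
    unfolding quad_form_def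
    by (intro borel_measurable_sum borel_measurable_times borel_measurable_const measurable_gauss_component) auto
  have SU: "?S (U z) = (\<Sum>p\<in>?J. l (snd p) * (z p)\<^sup>2)" for z
  proof -
    have "?S (U z) = (\<Sum>j<m. quad_form N B (T (\<lambda>i. z (j, i))))"
      by (intro sum.cong refl) (simp add: U_def)
    also have "\<dots> = (\<Sum>j<m. \<Sum>i<N. l i * (z (j, i))\<^sup>2)" by (simp add: l)
    also have "\<dots> = (\<Sum>p\<in>?J. l (snd p) * (z p)\<^sup>2)"
      by (subst sum.cartesian_product) (simp add: case_prod_unfold)
    finally show ?thesis .
  qed
  have "distr ?P borel ?S = distr (distr ?P ?P U) borel ?S" using U(2) by simp
  also have "\<dots> = chi_mix ?J (\<lambda>p. l (snd p))"
    unfolding chi_mix_def using U(1) S by (subst distr_distr) (auto simp: comp_def SU)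
  finally have "measure (chi_mix ?J (\<lambda>p. l (snd p))) {c..} = measure (distr ?P borel ?S) {c..}" by simp
  also have "\<dots> = measure ?P {z \<in> space ?P. c \<le> ?S z}"
    by (subst measure_distr[OF S]) (auto intro!: arg_cong[where f = "measure ?P"])
  finally show ?thesis unfolding gauss_samples_def ..
qed

lemma measure_chi_mix_scale:
  assumes "c > 0"
  shows "measure (chi_mix I (\<lambda>i. c * w i)) {t..} = measure (chi_mix I w) {t / c..}"
proof -
  have "chi_mix I (\<lambda>i. c * w i) = distr (chi_mix I w) borel ((*) c)"
    unfolding chi_mix_def
    by (subst distr_distr) (auto simp: comp_def sum_distrib_left mult.assoc intro: measurable_sum_squares)
  then have "measure (chi_mix I (\<lambda>i. c * w i)) {t..} = measure (distr (chi_mix I w) borel ((*) c)) {t..}" by simp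
  also have "\<dots> = measure (chi_mix I w) ((*) c -` {t..} \<inter> space (chi_mix I w))"
    by (rule measure_distr) auto
  also have "(*) c -` {t..} \<inter> space (chi_mix I w) = {t / c..}"
    using assms by (auto simp: field_simps)
  finally show ?thesis .
qed

lemma trG_quad_form: "trG m N B z = (\<Sum>j<m. quad_form N B (\<lambda>i. z (j, i))) / real m"
  by (simp add: trG_def quad_form_def)

text \<open>The factor \<open>c\<close> normalises the largest weight. It is used for A with the
  spectral norm as \<open>c\<close> and the trace as \<open>\<tau>\<close>, and for A_rel with
  \<open>c\<close> = 1/\<mu> and \<open>\<tau>\<close> = 1; in both cases \<open>\<tau> / c\<close>
  is \<mu>.\<close>

lemma measure_deviation:
  assumes T: "T \<in> rotations {..<N}" and l: "\<And>x. quad_form N B (T x) = (\<Sum>i<N. c * w i * (x i)\<^sup>2)"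
    and nonneg: "\<And>x. quad_form N B x \<ge> 0" and pos: "c > 0" "\<tau> > 0" "m \<ge> 1" and \<epsilon>: "\<epsilon> > 1"
  shows "measure (gauss_samples m N) {z \<in> space (gauss_samples m N). \<bar>trG m N B z - \<tau>\<bar> \<ge> \<epsilon> * \<tau>}
    = measure (chi_mix ({..<m} \<times> {..<N}) (\<lambda>p. w (snd p))) {real m * (\<tau> / c) * (1 + \<epsilon>)..}"
proof -
  have "\<bar>trG m N B z - \<tau>\<bar> \<ge> \<epsilon> * \<tau> \<longleftrightarrow> real m * \<tau> * (1 + \<epsilon>) \<le> (\<Sum>j<m. quad_form N B (\<lambda>i. z (j, i)))" for z
  proof -
    have "trG m N B z \<ge> 0" unfolding trG_quad_form by (intro divide_nonneg_nonneg sum_nonneg nonneg) simp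
    moreover have "\<epsilon> * \<tau> > \<tau>" using pos \<epsilon> by simp
    ultimately have "\<bar>trG m N B z - \<tau>\<bar> \<ge> \<epsilon> * \<tau> \<longleftrightarrow> \<tau> * (1 + \<epsilon>) \<le> trG m N B z"
      by (auto simp: algebra_simps abs_if)
    also have "\<dots> \<longleftrightarrow> real m * \<tau> * (1 + \<epsilon>) \<le> (\<Sum>j<m. quad_form N B (\<lambda>i. z (j, i)))"
      unfolding trG_quad_form using pos by (simp add: field_simps)
    finally show ?thesis .
  qed
  then show ?thesis
    using measure_quad_form_ge[OF T, of B "\<lambda>i. c * w i" m "real m * \<tau> * (1 + \<epsilon>)"] l pos
    by (simp add: measure_chi_mix_scale)
qed

text \<open>The lower part of the event lies in the negative reals, where the density vanishes.
  Changing the rate from \<open>a\<close> to 1/2 stretches by \<open>2 * a\<close>; for a = m \<mu>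
  / 2 this is the level of the estimators.\<close>

lemma measure_gamma_deviation:
  assumes "a > 0" "\<epsilon> > 1"
  shows "measure (gamma_measure a a) {x. \<bar>x - 1\<bar> \<ge> \<epsilon>} = gamma_tail a (2 * a * (1 + \<epsilon>))"
proof -
  have "emeasure (gamma_measure a a) {x. \<bar>x - 1\<bar> \<ge> \<epsilon>} = emeasure (gamma_measure a a) {1 + \<epsilon>..}"
  proof -
    have m: "{x::real. \<bar>x - 1\<bar> \<ge> \<epsilon>} \<in> sets borel" by simp
    have "ennreal (gamma_density a a x) * indicator {x. \<bar>x - 1\<bar> \<ge> \<epsilon>} x
      = ennreal (gamma_density a a x) * indicator {1 + \<epsilon>..} x" for x
      using assms by (auto simp: gamma_density_def indicator_def)
    then show ?thesis
      unfolding gamma_measure_def using m by (simp add: emeasure_density)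
  qed
  also have "\<dots> = emeasure (gamma_measure a (a / (2 * a))) {2 * a * (1 + \<epsilon>)..}"
    by (rule emeasure_gamma_scale) (use assms in auto)
  also have "a / (2 * a) = 1 / 2" using assms by simp
  finally show ?thesis by (simp add: measure_def gamma_tail_def)
qed

lemma quad_form_A_rel:
  assumes "\<mu> \<ge> 1"
  shows "quad_form N (A_rel \<mu>) x = (\<Sum>i<N. 1 / \<mu> * rel_weight \<mu> i * (x i)\<^sup>2)"
proof -
  have "(\<Sum>j<N. x i * A_rel \<mu> i j * x j) = 1 / \<mu> * rel_weight \<mu> i * (x i)\<^sup>2" if "i < N" for i
  proof -
    have "(\<Sum>j<N. x i * A_rel \<mu> i j * x j) = (\<Sum>j<N. if j = i then 1 / \<mu> * rel_weight \<mu> i * (x i)\<^sup>2 else 0)"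
      by (rule sum.cong) (auto simp: A_rel_def rel_weight_def power2_eq_square)
    then show ?thesis using that by simp
  qed
  then show ?thesis unfolding quad_form_def by (intro sum.cong) auto
qed

theorem theorem6:
  fixes n m :: nat and A :: "nat \<Rightarrow> nat \<Rightarrow> real"
  assumes "mat_psd n A" and "mat_nonzero n A" and "m \<ge> 1"
  defines "\<mu> \<equiv> eff_rank n A"
  shows "\<exists>\<epsilon>_rel. \<forall>\<epsilon>\<ge>\<epsilon>_rel.
     measure (gauss_samples m n)
       {z \<in> space (gauss_samples m n). \<bar>trG m n A z - mat_trace n A\<bar> \<ge> \<epsilon> * mat_trace n A}
     \<le> measure (gauss_samples m (A_rel_dim \<mu>))
       {z \<in> space (gauss_samples m (A_rel_dim \<mu>)). \<bar>trG m (A_rel_dim \<mu>) (A_rel \<mu>) z - 1\<bar> \<ge> \<epsilon>}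
   \<and> measure (gauss_samples m (A_rel_dim \<mu>))
       {z \<in> space (gauss_samples m (A_rel_dim \<mu>)). \<bar>trG m (A_rel_dim \<mu>) (A_rel \<mu>) z - 1\<bar> \<ge> \<epsilon>}
     \<le> measure (gamma_measure (real m * \<mu> / 2) (real m * \<mu> / 2)) {x. \<bar>x - 1\<bar> \<ge> \<epsilon>}"
proof -
  obtain T l where T: "T \<in> rotations {..<n}" "\<And>x. quad_form n A (T x) = (\<Sum>i<n. l i * (x i)\<^sup>2)"
    and l: "\<And>i. i < n \<Longrightarrow> 0 \<le> l i" "\<And>i. i < n \<Longrightarrow> l i \<le> spec_norm n A" "\<exists>i<n. l i = spec_norm n A"
    and tr: "(\<Sum>i<n. l i) = mat_trace n A" and s: "0 < spec_norm n A"
    using psd_spectrum[OF assms(1,2)] by blast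
  define \<sigma> where "\<sigma> = spec_norm n A"
  define x where "x i = l i / \<sigma>" for i
  have \<sigma>: "\<sigma> > 0" and lx: "l i = \<sigma> * x i" for i using s by (auto simp: \<sigma>_def x_def)
  have x: "0 \<le> x i \<and> x i \<le> 1" if "i \<in> {..<n}" for i
    using l that \<sigma> by (simp add: x_def \<sigma>_def)
  have top: "\<exists>i\<in>{..<n}. x i = 1" using l(3) \<sigma> by (force simp: x_def \<sigma>_def)
  have sum: "sum x {..<n} = \<mu>"
    unfolding x_def \<mu>_def eff_rank_def by (simp add: sum_divide_distrib[symmetric] tr \<sigma>_def)
  \<comment> \<open>One normalised weight equals 1 and all are nonnegative.\<close>
  have \<mu>: "\<mu> \<ge> 1"
  proof -
    obtain i where "i < n" "x i = 1" using top by auto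
    then show ?thesis using member_le_sum[of i "{..<n}" x] x sum by simp
  qed
  have trpos: "mat_trace n A > 0" and tr\<sigma>: "mat_trace n A / \<sigma> = \<mu>"
    using \<mu> \<sigma> unfolding \<mu>_def eff_rank_def \<sigma>_def[symmetric] by (auto simp: field_simps)
  define Y where "Y = chi_mix ({..<m} \<times> {..<Suc (nat \<lfloor>\<mu>\<rfloor>)}) (\<lambda>p. rel_weight \<mu> (snd p))"
  have "eventually (\<lambda>t. measure (chi_mix ({..<m} \<times> {..<n}) (\<lambda>p. x (snd p))) {t..} \<le> measure Y {t..}
      \<and> measure Y {t..} \<le> gamma_tail (real m * \<mu> / 2) t) at_top"
    unfolding Y_def
    by (intro eventually_conj mix_le_rel rel_le_gamma) (use \<mu> assms(3) x top sum in auto)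
  then obtain t0 where t0: "\<And>t. t \<ge> t0 \<Longrightarrow>
      measure (chi_mix ({..<m} \<times> {..<n}) (\<lambda>p. x (snd p))) {t..} \<le> measure Y {t..}
      \<and> measure Y {t..} \<le> gamma_tail (real m * \<mu> / 2) t"
    by (auto simp: eventually_at_top_linorder)
  show ?thesis
  \<comment> \<open>The 2 guarantees deviations above 1. The bound \<open>t0\<close> for the level
    transfers to \<epsilon> because m * \<mu> \<ge> 1 gives t \<ge> 1 + \<epsilon>.\<close>
  proof (intro exI[of _ "max 2 t0"] allI impI)
    fix \<epsilon> assume \<epsilon>: "max 2 t0 \<le> \<epsilon>"
    define t where "t = real m * \<mu> * (1 + \<epsilon>)"
    have "1 * (1 + \<epsilon>) \<le> real m * \<mu> * (1 + \<epsilon>)"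
      using \<mu> assms(3) \<epsilon> mult_mono[of 1 "real m" 1 \<mu>] by (intro mult_right_mono) auto
    moreover have "t0 \<le> \<epsilon>" using \<epsilon> by simp
    ultimately have t: "t \<ge> t0" unfolding t_def mult_1 by linarith
    have 1: "measure (gauss_samples m n)
       {z \<in> space (gauss_samples m n). \<bar>trG m n A z - mat_trace n A\<bar> \<ge> \<epsilon> * mat_trace n A}
      = measure (chi_mix ({..<m} \<times> {..<n}) (\<lambda>p. x (snd p))) {t..}"
      using measure_deviation[OF T(1), of A \<sigma> x "mat_trace n A" m \<epsilon>] T(2) assms(1,3) \<epsilon> \<sigma> trpos
      by (simp add: lx tr\<sigma> t_def mat_psd_def)
    have nonneg: "quad_form N (A_rel \<mu>) v \<ge> 0" for N v
      unfolding quad_form_A_rel[OF \<mu>] using \<mu>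
      by (intro sum_nonneg mult_nonneg_nonneg) (auto simp: rel_weight_def)
    \<comment> \<open>A_rel is already diagonal, so the identity serves as the rotation.\<close>
    have 2: "measure (gauss_samples m (A_rel_dim \<mu>))
       {z \<in> space (gauss_samples m (A_rel_dim \<mu>)). \<bar>trG m (A_rel_dim \<mu>) (A_rel \<mu>) z - 1\<bar> \<ge> \<epsilon>}
      = measure Y {t..}"
      using measure_deviation[OF rotations_id quad_form_A_rel[OF \<mu>] nonneg, of 1 m \<epsilon>] assms(3) \<epsilon> \<mu>
      by (simp add: A_rel_dim_def t_def Y_def)
    have 3: "measure (gamma_measure (real m * \<mu> / 2) (real m * \<mu> / 2)) {x. \<bar>x - 1\<bar> \<ge> \<epsilon>}
      = gamma_tail (real m * \<mu> / 2) t"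
      using measure_gamma_deviation[of "real m * \<mu> / 2" \<epsilon>] \<mu> assms(3) \<epsilon> by (simp add: t_def)
    show "measure (gauss_samples m n)
       {z \<in> space (gauss_samples m n). \<bar>trG m n A z - mat_trace n A\<bar> \<ge> \<epsilon> * mat_trace n A}
     \<le> measure (gauss_samples m (A_rel_dim \<mu>))
       {z \<in> space (gauss_samples m (A_rel_dim \<mu>)). \<bar>trG m (A_rel_dim \<mu>) (A_rel \<mu>) z - 1\<bar> \<ge> \<epsilon>}
   \<and> measure (gauss_samples m (A_rel_dim \<mu>))
       {z \<in> space (gauss_samples m (A_rel_dim \<mu>)). \<bar>trG m (A_rel_dim \<mu>) (A_rel \<mu>) z - 1\<bar> \<ge> \<epsilon>}
     \<le> measure (gamma_measure (real m * \<mu> / 2) (real m * \<mu> / 2)) {x. \<bar>x - 1\<bar> \<ge> \<epsilon>}"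
      unfolding 1 2 3 by (rule t0[OF t])
  qed
qed

end
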